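(* Let $n\ge2$ be an integer, let $C>\frac1n$ and let $r_0>0$. Then there is a unique solution $r(h)$, $h\in\mathbb{R}$, of \[ \frac{r''}{1+r'^2}=\frac{n-1}{r}-\frac{1+r'^2}{C(r-hr')} \] that is symmetric about the $r$-axis (i.e. $r(-h)=r(h)$) and satisfies the initial conditions $r(0)=r_0$, $r'(0)=0$. Moreover, the solution has the following behavior, depending on $C$: (1) If $C=\frac1{n-1}$, then $r(h)\equiv r_0$. (2) If $C>\frac1{n-1}$, then $r(h)$ has a global minimum at $h=0$, there exists a point $h_1>0$ such that $r''(h)$ has the same sign as $h_1-|h|$, and $\lim_{h\to\infty}r(h)=\infty$. (3) If $\frac1n<C<\frac1{n-1}$, then $r(h)$ has a global maximum at $h=0$, there exists a point $h_1>0$ such that $r''(h)$ has the same sign as $|h|-h_1$, and $\lim_{h\to\infty}r(h)=0$.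
   Context: A solution of the differential equation on an interval is a twice differentiable function $r=r(h)>0$ with $r-hr'\ne0$ on the interval satisfying the equation there; primes denote $d/dh$. (The equation says that rotating the profile curve $(r(h),h)$ about the $h$-axis in $\mathbb{R}^{n+1}$ gives a hypersurface satisfying $-\langle\overrightarrow{H},X\rangle=\frac1C$, where $X$ is the position vector and $\overrightarrow H$ the mean curvature vector, i.e. a homothetic expander for the inverse mean curvature flow.) *)

theory Defs
  imports "HOL-Analysis.Analysis"
begin

text \<open>
  The set \<open>I\<close> is meant to be an open interval (possibly all of \<open>UNIV\<close>), so that the two-sided
  derivatives at its points depend only on the values of \<open>r\<close> on \<open>I\<close>.  The differentiability
  conditions are essential: \<open>deriv\<close> takes an unspecified value where no derivative exists.
\<close>

definition expander_solution_on :: "nat \<Rightarrow> real \<Rightarrow> real set \<Rightarrow> (real \<Rightarrow> real) \<Rightarrow> bool" where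
  "expander_solution_on n C I r \<longleftrightarrow>
     open I \<and> is_interval I \<and>
     (\<forall>h\<in>I. r differentiable (at h) \<and> deriv r differentiable (at h) \<and>
        r h > 0 \<and> r h - h * deriv r h \<noteq> 0 \<and>
        deriv (deriv r) h / (1 + (deriv r h)\<^sup>2)
          = (real n - 1) / r h - (1 + (deriv r h)\<^sup>2) / (C * (r h - h * deriv r h)))"

definition symmetric_expander :: "nat \<Rightarrow> real \<Rightarrow> real \<Rightarrow> (real \<Rightarrow> real) \<Rightarrow> bool" where
  "symmetric_expander n C r\<^sub>0 r \<longleftrightarrow>
     expander_solution_on n C UNIV r \<and> (\<forall>h. r (- h) = r h) \<and> r 0 = r\<^sub>0 \<and> deriv r 0 = 0"

end

theory Submission
  imports Defs
begin

text \<open>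
  The equation is invariant under \<open>(h, r) \<mapsto> (\<lambda>h, \<lambda>r)\<close>.  With \<open>s = h / r\<close>, \<open>x = r'\<close> and
  \<open>k = n - 1\<close> it becomes the first order equation \<open>dx/ds = A (k - A / C)\<close>, where
  \<open>A = (1 + x\<^sup>2) / (1 - s x)\<close>, together with the quadratures \<open>d(ln r)/ds = x / (1 - s x)\<close> and
  \<open>h = s r\<close>, where \<open>dh/ds = r / (1 - s x) > 0\<close>.  Let \<open>\<sigma>\<close> be the sign of \<open>k C - 1\<close>.  For
  \<open>s \<ge> 0\<close> the curves \<open>\<sigma> \<nu> s / (1 + s\<^sup>2)\<close> and \<open>\<sigma> \<mu> s / (1 + \<epsilon> s\<^sup>2)\<close> with suitable constants are
  barriers; clamping the right-hand side between them makes it Lipschitz, so Picard iteration gives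
  a solution for all \<open>s\<close>.  The upper barrier keeps \<open>1 - s x\<close> positive and bounds the decay of \<open>r\<close>,
  so that \<open>h = s r\<close> ranges over all of \<open>\<real>\<close>; the lower one forces \<open>\<sigma> ln r \<rightarrow> \<infinity>\<close>.  The function
  \<open>N = k (1 - s x) - (1 + x\<^sup>2) / C\<close> has the sign of \<open>r''\<close>, and \<open>dN/ds = - k x\<close> at its zeros, so
  it changes sign exactly once on \<open>s > 0\<close>.
\<close>

subsection \<open>Scalar differential equations on the half-line\<close>

lemma nonincreasing_within:
  fixes d d' :: "real \<Rightarrow> real"
  assumes "a \<le> b"
    and der: "\<And>s. s \<in> {a..b} \<Longrightarrow> (d has_real_derivative d' s) (at s within {a..b})"
    and neg: "\<And>s. s \<in> {a<..<b} \<Longrightarrow> d' s \<le> 0"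
  shows "d b \<le> d a"
proof (cases "a = b")
  case False
  then have "a < b" using assms(1) by simp
  then obtain x where x: "x \<in> {a<..<b}" "d b - d a = d' x * (b - a)"
    using mvt_simple[of a b d "\<lambda>x. (*) (d' x)"] der by (auto simp: has_field_derivative_def)
  then have "d' x * (b - a) \<le> 0" using neg[of x] \<open>a < b\<close> by (simp add: mult_nonpos_nonneg)
  then show ?thesis using x by simp
qed simp

text \<open>The integrating factor \<open>exp (- K * s)\<close> turns the differential inequality
  into monotonicity of \<open>exp (- K * s) * d s\<close>. Both uniqueness proofs apply this to a
  squared distance.\<close>

lemma gronwall_nonpos:
  fixes d d' :: "real \<Rightarrow> real"
  assumes der: "\<And>s. s \<in> {0..S} \<Longrightarrow> (d has_real_derivative d' s) (at s within {0..S})"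
    and le: "\<And>s. s \<in> {0..S} \<Longrightarrow> d' s \<le> K * d s"
    and "d 0 \<le> 0" "s \<in> {0..S}"
  shows "d s \<le> 0"
proof -
  have "exp (- K * s) * d s \<le> exp (- K * 0) * d 0"
  proof (rule nonincreasing_within[where d = "\<lambda>s. exp (- K * s) * d s" and d' = "\<lambda>t. exp (- K * t) * (d' t - K * d t)"])
    show "((\<lambda>s. exp (- K * s) * d s) has_real_derivative exp (- K * t) * (d' t - K * d t))
        (at t within {0..s})" if "t \<in> {0..s}" for t
    proof -
      have "(d has_real_derivative d' t) (at t within {0..s})"
        using der[of t] that assms(4) by (auto intro: DERIV_subset)
      then show ?thesis
        by (auto intro!: derivative_eq_intros simp: algebra_simps)
    qed
    show "exp (- K * t) * (d' t - K * d t) \<le> 0" if "t \<in> {0<..<s}" for t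
      using le[of t] that assms(4) by (simp add: mult_nonneg_nonpos)
  qed (use assms(4) in auto)
  then have "exp (- K * s) * d s \<le> 0" using \<open>d 0 \<le> 0\<close> by simp
  then show ?thesis by (simp add: mult_le_0_iff)
qed

text \<open>Let \<open>z\<close> be the last time up to \<open>s\<close> with
  \<open>d z \<le> 0\<close>; between \<open>z\<close> and \<open>s\<close> the function is
  positive, hence nonincreasing, so it cannot have become positive. The sign of \<open>d'\<close> is
  demanded only where \<open>d > 0\<close>, that is, where a clamped right-hand side takes its value
  on the barrier.\<close>

lemma stays_nonpos:
  fixes d d' :: "real \<Rightarrow> real"
  assumes der: "\<And>s. s \<ge> 0 \<Longrightarrow> (d has_real_derivative d' s) (at s within {0..})"
    and le: "\<And>s. s > 0 \<Longrightarrow> d s > 0 \<Longrightarrow> d' s \<le> 0"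
    and "d 0 \<le> 0" "s \<ge> 0"
  shows "d s \<le> 0"
proof (rule ccontr)
  assume "\<not> d s \<le> 0"
  then have ds: "d s > 0" by simp
  have cont: "continuous_on {0..s} d"
    by (rule DERIV_continuous_on[where D = d']) (auto intro: DERIV_subset[OF der])
  let ?Z = "{0..s} \<inter> d -` {..0}"
  have "closed ?Z" using cont by (intro continuous_closed_preimage) auto
  then have cpt: "compact ?Z"
    by (metis bounded_Int bounded_closed_interval compact_eq_bounded_closed)
  have ne: "?Z \<noteq> {}" using assms(3,4) by force
  from compact_attains_sup[OF cpt ne] obtain z where z: "z \<in> ?Z" "\<And>y. y \<in> ?Z \<Longrightarrow> y \<le> z" by blast
  have "d s \<le> d z"
  proof (rule nonincreasing_within[where d = d and d' = d'])
    show "z \<le> s" using z by simp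
    show "(d has_real_derivative d' t) (at t within {z..s})" if "t \<in> {z..s}" for t
      using that z by (auto intro!: DERIV_subset[OF der])
    show "d' t \<le> 0" if "t \<in> {z<..<s}" for t
    proof (rule le)
      show "t > 0" using that z by auto
      show "d t > 0" using z(2)[of t] that z(1) by force
    qed
  qed
  then show False using z(1) ds by simp
qed

text \<open>Banach's fixed point theorem in an exponentially weighted norm: with the solution
  written as \<open>exp (2 * L * t) * u t\<close>, the integral operator for \<open>u\<close>
  contracts with factor 1/2 on all of \<open>{0..S}\<close>, whatever its length, so no continuation
  in small steps occurs.\<close>

lemma picard_interval:
  fixes F :: "real \<Rightarrow> real \<Rightarrow> real"
  assumes "0 \<le> S" "0 < L"
    and cont: "continuous_on ({0..S} \<times> UNIV) (\<lambda>(s, x). F s x)"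
    and lip: "\<And>s x y. s \<in> {0..S} \<Longrightarrow> \<bar>F s x - F s y\<bar> \<le> L * \<bar>x - y\<bar>"
  shows "\<exists>p. p 0 = 0 \<and> (\<forall>s\<in>{0..S}. (p has_real_derivative F s (p s)) (at s within {0..S}))"
proof -
  \<comment> \<open>Precomposing with this retraction onto \<open>{0..S}\<close> turns a continuous
    function on the interval into a bounded continuous function on the whole line, an element of the
    complete space in which the fixed point is sought.\<close>
  define c where "c s = max 0 (min s S)" for s
  have c_in: "c s \<in> {0..S}" for s using \<open>0 \<le> S\<close> by (auto simp: c_def)
  have c_id: "c s = s" if "s \<in> {0..S}" for s using that by (auto simp: c_def)
  have c_cont: "continuous_on UNIV c" unfolding c_def by (intro continuous_intros)
  define \<phi> where "\<phi> u t = F t (exp (2 * L * t) * apply_bcontfun u t)"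
    for u :: "real \<Rightarrow>\<^sub>C real" and t
  have \<phi>_cont: "continuous_on {0..S} (\<phi> u)" for u
  proof -
    have "continuous_on {0..S} (\<lambda>t. (t, exp (2 * L * t) * apply_bcontfun u t))"
      by (intro continuous_intros) auto
    then have "continuous_on {0..S} ((\<lambda>(s, x). F s x) \<circ> (\<lambda>t. (t, exp (2 * L * t) * apply_bcontfun u t)))"
      by (intro continuous_on_compose continuous_on_subset[OF cont]) auto
    then show ?thesis by (simp add: \<phi>_def o_def)
  qed
  have \<phi>_int: "\<phi> u integrable_on {0..t}" if "t \<le> S" for u t
    using that by (intro integrable_continuous_real continuous_on_subset[OF \<phi>_cont]) auto
  define J where "J u x = integral {0..x} (\<phi> u)" for u x
  have J_der: "(J u has_real_derivative \<phi> u t) (at t within {0..S})" if "t \<in> {0..S}" for u t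
    unfolding J_def by (rule integral_has_real_derivative[OF \<phi>_cont that])
  have J_cont: "continuous_on {0..S} (J u)" for u
    by (rule DERIV_continuous_on[where D = "\<phi> u"]) (rule J_der)
  define w where "w u t = exp (- 2 * L * t) * J u t" for u t
  have w_cont: "continuous_on {0..S} (w u)" for u
    unfolding w_def by (intro continuous_intros J_cont)
  have wc: "(\<lambda>t. w u (c t)) \<in> bcontfun" for u
  proof -
    have "continuous_on UNIV (w u \<circ> c)"
      by (intro continuous_on_compose c_cont continuous_on_subset[OF w_cont]) (use c_in in auto)
    moreover have "bounded (w u ` {0..S})"
      by (intro compact_imp_bounded compact_continuous_image w_cont) auto
    then have "bounded (range (\<lambda>t. w u (c t)))"
      by (rule bounded_subset) (use c_in in auto)
    ultimately show ?thesis by (simp add: bcontfun_def o_def)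
  qed
  define T where "T u = Bcontfun (\<lambda>t. w u (c t))" for u
  have T_app: "apply_bcontfun (T u) t = w u (c t)" for u t
    using wc by (simp add: T_def Bcontfun_inverse)
  have contr: "dist (T u) (T v) \<le> 1 / 2 * dist u v" for u v
  proof (rule dist_bound)
    fix s
    define t where "t = c s"
    have t: "0 \<le> t" "t \<le> S" using c_in[of s] by (auto simp: t_def)
    define D where "D = dist u v"
    have J_diff: "\<bar>J u t - J v t\<bar> \<le> integral {0..t} (\<lambda>\<tau>. L * D * exp (2 * L * \<tau>))"
    proof -
      have "J u t - J v t = integral {0..t} (\<lambda>\<tau>. \<phi> u \<tau> - \<phi> v \<tau>)"
        unfolding J_def by (rule Henstock_Kurzweil_Integration.integral_diff[symmetric])
          (use \<phi>_int t in auto)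
      moreover have "norm (integral {0..t} (\<lambda>\<tau>. \<phi> u \<tau> - \<phi> v \<tau>)) \<le> integral {0..t} (\<lambda>\<tau>. L * D * exp (2 * L * \<tau>))"
      proof (rule integral_norm_bound_integral)
        show "(\<lambda>\<tau>. \<phi> u \<tau> - \<phi> v \<tau>) integrable_on {0..t}"
          using \<phi>_int t by (intro integrable_diff) auto
        show "(\<lambda>\<tau>. L * D * exp (2 * L * \<tau>)) integrable_on {0..t}"
          by (intro integrable_continuous_real continuous_intros)
        fix \<tau> assume \<tau>: "\<tau> \<in> {0..t}"
        have "\<bar>\<phi> u \<tau> - \<phi> v \<tau>\<bar> \<le> L * \<bar>exp (2 * L * \<tau>) * apply_bcontfun u \<tau> - exp (2 * L * \<tau>) * apply_bcontfun v \<tau>\<bar>"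
          unfolding \<phi>_def using \<tau> t by (intro lip) auto
        also have "\<dots> = L * exp (2 * L * \<tau>) * dist (apply_bcontfun u \<tau>) (apply_bcontfun v \<tau>)"
          by (simp add: dist_real_def abs_mult flip: right_diff_distrib)
        also have "\<dots> \<le> L * exp (2 * L * \<tau>) * D"
          unfolding D_def using \<open>0 < L\<close> by (intro mult_left_mono dist_bounded) auto
        finally show "norm (\<phi> u \<tau> - \<phi> v \<tau>) \<le> L * D * exp (2 * L * \<tau>)" by (simp add: mult_ac)
      qed
      ultimately show ?thesis by simp
    qed
    \<comment> \<open>The antiderivative brings in the factor \<open>1 / (2 * L)\<close>, and the
      weight in \<open>w\<close> then cancels the exponential: this is the source of the contraction
      factor 1/2.\<close>
    have "((\<lambda>\<tau>. L * D * exp (2 * L * \<tau>)) has_integral (D / 2 * exp (2 * L * t) - D / 2 * exp (2 * L * 0))) {0..t}"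
      using t \<open>0 < L\<close>
      by (intro fundamental_theorem_of_calculus)
         (auto intro!: derivative_eq_intros simp flip: has_real_derivative_iff_has_vector_derivative)
    then have "integral {0..t} (\<lambda>\<tau>. L * D * exp (2 * L * \<tau>)) = D / 2 * exp (2 * L * t) - D / 2"
      by (simp only: integral_unique) simp
    also have "\<dots> \<le> D / 2 * exp (2 * L * t)" by (simp add: D_def)
    finally have "\<bar>J u t - J v t\<bar> \<le> D / 2 * exp (2 * L * t)" using J_diff by simp
    then have "exp (- 2 * L * t) * \<bar>J u t - J v t\<bar> \<le> exp (- 2 * L * t) * (D / 2 * exp (2 * L * t))"
      by (intro mult_left_mono) auto
    also have "\<dots> = D / 2" by (simp add: exp_minus field_simps)
    finally show "dist (apply_bcontfun (T u) s) (apply_bcontfun (T v) s) \<le> 1 / 2 * dist u v"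
      by (simp add: T_app w_def dist_real_def t_def D_def abs_mult flip: right_diff_distrib)
  qed
  have "\<exists>!u. T u = u"
    by (rule banach_fix_type[of "1/2"]) (use contr in auto)
  then obtain u where u: "T u = u" by blast
  have u_eq: "exp (2 * L * t) * apply_bcontfun u t = J u t" if "t \<in> {0..S}" for t
  proof -
    have "apply_bcontfun u t = exp (- 2 * L * t) * J u t"
      using T_app[of u t] u c_id[OF that] by (simp add: w_def)
    then show ?thesis by (simp add: exp_minus)
  qed
  have "(J u has_real_derivative F s (J u s)) (at s within {0..S})" if "s \<in> {0..S}" for s
    using J_der[OF that, of u] u_eq[OF that] by (simp add: \<phi>_def)
  moreover have "J u 0 = 0" by (simp add: J_def)
  ultimately show ?thesis by blast
qed

text \<open>Gronwall for the square of the difference, which is differentiable also where the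
  solutions meet.\<close>

lemma ode_unique_interval:
  fixes F :: "real \<Rightarrow> real \<Rightarrow> real"
  assumes lip: "\<And>s x y. s \<in> {0..S} \<Longrightarrow> \<bar>F s x - F s y\<bar> \<le> L * \<bar>x - y\<bar>"
    and p: "\<And>s. s \<in> {0..S} \<Longrightarrow> (p has_real_derivative F s (p s)) (at s within {0..S})"
    and q: "\<And>s. s \<in> {0..S} \<Longrightarrow> (q has_real_derivative F s (q s)) (at s within {0..S})"
    and "p 0 = q 0" "s \<in> {0..S}"
  shows "p s = q s"
proof -
  have "(p s - q s)\<^sup>2 \<le> 0"
  proof (rule gronwall_nonpos[where K = "2 * L" and d = "\<lambda>t. (p t - q t)\<^sup>2" and S = S
        and d' = "\<lambda>t. 2 * (p t - q t) * (F t (p t) - F t (q t))"])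
    fix t assume t: "t \<in> {0..S}"
    show "((\<lambda>t. (p t - q t)\<^sup>2) has_real_derivative 2 * (p t - q t) * (F t (p t) - F t (q t)))
        (at t within {0..S})"
      by (rule derivative_eq_intros p[OF t] q[OF t] | simp)+
    have "(p t - q t) * (F t (p t) - F t (q t)) \<le> \<bar>p t - q t\<bar> * \<bar>F t (p t) - F t (q t)\<bar>"
      by (metis abs_ge_self abs_mult)
    also have "\<dots> \<le> \<bar>p t - q t\<bar> * (L * \<bar>p t - q t\<bar>)"
      by (intro mult_left_mono lip t) auto
    also have "\<dots> = L * (p t - q t)\<^sup>2" by (simp add: power2_eq_square flip: abs_mult)
    finally show "2 * (p t - q t) * (F t (p t) - F t (q t)) \<le> 2 * L * (p t - q t)\<^sup>2"
      by linarith
  qed (use assms in auto)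
  then show ?thesis by simp
qed

text \<open>The solutions on the intervals \<open>{0..S}\<close> agree on overlaps by uniqueness and
  therefore glue, even if the Lipschitz constant grows with \<open>S\<close>.\<close>

lemma picard_halfline:
  fixes F :: "real \<Rightarrow> real \<Rightarrow> real"
  assumes cont: "continuous_on ({0..} \<times> UNIV) (\<lambda>(s, x). F s x)"
    and lip: "\<And>S. \<exists>L. \<forall>s\<in>{0..S}. \<forall>x y. \<bar>F s x - F s y\<bar> \<le> L * \<bar>x - y\<bar>"
  shows "\<exists>p. p 0 = 0 \<and> (\<forall>s\<ge>0. (p has_real_derivative F s (p s)) (at s within {0..}))"
proof -
  obtain L0 where L0: "\<And>S s x y. s \<in> {0..S} \<Longrightarrow> \<bar>F s x - F s y\<bar> \<le> L0 S * \<bar>x - y\<bar>"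
    using lip by metis
  \<comment> \<open>\<open>picard_interval\<close> asks for a positive constant, which
    \<open>L0 S\<close> need not be.\<close>
  define L where "L S = \<bar>L0 S\<bar> + 1" for S
  have L: "\<bar>F s x - F s y\<bar> \<le> L S * \<bar>x - y\<bar>" if "s \<in> {0..S}" for S s x y
    by (rule order_trans[OF L0[OF that]]) (auto simp: L_def intro!: mult_right_mono)
  have "\<exists>p. p 0 = 0 \<and> (\<forall>s\<in>{0..S}. (p has_real_derivative F s (p s)) (at s within {0..S}))"
    if "0 \<le> S" for S
    by (rule picard_interval[where L = "L S"])
       (use that in \<open>auto intro: continuous_on_subset[OF cont] L simp: L_def[symmetric]\<close>, simp add: L_def)
  then obtain q where q0: "\<And>S. 0 \<le> S \<Longrightarrow> q S 0 = 0" and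
    q: "\<And>S s. 0 \<le> S \<Longrightarrow> s \<in> {0..S} \<Longrightarrow> (q S has_real_derivative F s (q S s)) (at s within {0..S})"
    by metis
  have agree: "q S s = q S' s" if "s \<in> {0..S}" "S \<le> S'" for s S S'
    by (rule ode_unique_interval[where L = "L S" and S = S, OF L])
       (use that q0 in \<open>auto intro!: DERIV_subset[OF q]\<close>)
  define p where "p s = q s s" for s
  have "(p has_real_derivative F s (p s)) (at s within {0..})" if "s \<ge> 0" for s
  proof -
    \<comment> \<open>Going beyond \<open>s\<close> makes it differ from the right endpoint, so that
      the derivative within \<open>{0..s + 1}\<close> is the one within
      \<open>{0..}\<close>.\<close>
    have "(q (s + 1) has_real_derivative F s (q (s + 1) s)) (at s within {0..s + 1})"
      by (rule q) (use that in auto)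
    moreover have eq: "p t = q (s + 1) t" if "t \<in> {0..s + 1}" for t
      unfolding p_def by (rule agree) (use that in auto)
    ultimately have "(p has_real_derivative F s (p s)) (at s within {0..s + 1})"
      using that has_field_derivative_transform_within[of "q (s + 1)" _ s "{0..s + 1}" 1 p] by simp
    moreover have "at s within {0..s + 1} = at s within {0..}"
      by (rule at_within_nhd[of _ "{..<s + 1}"]) auto
    ultimately show ?thesis by simp
  qed
  moreover have "p 0 = 0" by (simp add: p_def q0)
  ultimately show ?thesis by blast
qed

subsection \<open>The first order equation\<close>

definition slope_field :: "real \<Rightarrow> real \<Rightarrow> real \<Rightarrow> real \<Rightarrow> real" where
  "slope_field k C s x = (1 + x\<^sup>2) / (1 - s * x) * (k - (1 + x\<^sup>2) / (1 - s * x) / C)"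

lemma slope_field_uminus: "slope_field k C (- s) (- x) = slope_field k C s x"
  by (simp add: slope_field_def)

lemma slope_field_continuous:
  assumes "continuous_on T a" "continuous_on T b" "\<And>t. t \<in> T \<Longrightarrow> 1 - a t * b t \<noteq> 0" "C \<noteq> 0"
  shows "continuous_on T (\<lambda>t. slope_field k C (a t) (b t))"
  unfolding slope_field_def by (intro continuous_intros assms) (use assms in auto)

text \<open>With \<open>A x = (1 + x\<^sup>2) / (1 - s * x)\<close> the field is
  \<open>A x * (k - A x / C)\<close>, and its difference factors as
  \<open>(A x - A y) * (k - (A x + A y) / C)\<close>. The constant is a Lipschitz bound for
  \<open>A\<close> times a bound for the second factor; both need \<open>1 - s * x\<close> bounded
  away from 0.\<close>

lemma slope_field_lipschitz:
  assumes "0 \<le> k" "0 < C" "0 < m" "0 \<le> M" "\<bar>s\<bar> \<le> S"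
    and x: "\<bar>x\<bar> \<le> M" "m \<le> 1 - s * x" and y: "\<bar>y\<bar> \<le> M" "m \<le> 1 - s * y"
  shows "\<bar>slope_field k C s x - slope_field k C s y\<bar>
    \<le> (2 * M * (1 + S * M) + S * (1 + M\<^sup>2)) / m\<^sup>2 * (k + 2 * ((1 + M\<^sup>2) / m) / C) * \<bar>x - y\<bar>"
proof -
  define A where "A x = (1 + x\<^sup>2) / (1 - s * x)" for x
  define La where "La = (2 * M * (1 + S * M) + S * (1 + M\<^sup>2)) / m\<^sup>2"
  define B where "B = (1 + M\<^sup>2) / m"
  have pos: "1 - s * x > 0" "1 - s * y > 0" using x y \<open>0 < m\<close> by auto
  have S0: "0 \<le> S" using assms(5) by linarith
  have sq: "z\<^sup>2 \<le> M\<^sup>2" if "\<bar>z\<bar> \<le> M" for z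
    using that by (metis abs_le_square_iff abs_of_nonneg assms(4))
  have sy: "\<bar>s * y\<bar> \<le> S * M"
    using y assms(5) S0 by (simp add: abs_mult mult_mono)
  have La0: "0 \<le> La" unfolding La_def using S0 assms by auto
  have A_bound: "0 \<le> A z \<and> A z \<le> B" if "\<bar>z\<bar> \<le> M" "m \<le> 1 - s * z" for z
    unfolding A_def B_def using that sq[of z] \<open>0 < m\<close> by (auto intro!: frac_le divide_nonneg_nonneg)
  have A_eq: "A x - A y = (x - y) * (((x + y) * (1 - s * y) + s * (1 + y\<^sup>2)) / ((1 - s * x) * (1 - s * y)))"
    unfolding A_def using pos by (simp add: divide_simps) (simp add: algebra_simps power2_eq_square)
  have quot: "\<bar>((x + y) * (1 - s * y) + s * (1 + y\<^sup>2)) / ((1 - s * x) * (1 - s * y))\<bar> \<le> La"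
  proof -
    have "\<bar>x + y\<bar> * \<bar>1 - s * y\<bar> \<le> 2 * M * (1 + S * M)"
      using x y sy assms(4) by (intro mult_mono) auto
    moreover have "\<bar>s\<bar> * \<bar>1 + y\<^sup>2\<bar> \<le> S * (1 + M\<^sup>2)"
      using assms(5) sq[OF y(1)] S0 by (intro mult_mono) auto
    ultimately have "\<bar>(x + y) * (1 - s * y) + s * (1 + y\<^sup>2)\<bar> \<le> 2 * M * (1 + S * M) + S * (1 + M\<^sup>2)"
      by (intro order_trans[OF abs_triangle_ineq]) (simp add: abs_mult)
    moreover have "m\<^sup>2 \<le> (1 - s * x) * (1 - s * y)"
      unfolding power2_eq_square using x y \<open>0 < m\<close> by (intro mult_mono) auto
    ultimately show ?thesis unfolding La_def using pos \<open>0 < m\<close>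
      by (simp add: abs_mult) (intro frac_le, auto)
  qed
  have A_diff: "\<bar>A x - A y\<bar> \<le> La * \<bar>x - y\<bar>"
    unfolding A_eq abs_mult[of "x - y"] by (subst mult.commute) (intro mult_right_mono quot abs_ge_zero)
  have "slope_field k C s x - slope_field k C s y = (A x - A y) * (k - (A x + A y) / C)"
    unfolding slope_field_def A_def[symmetric] by (simp add: algebra_simps diff_divide_distrib add_divide_distrib)
  then have "\<bar>slope_field k C s x - slope_field k C s y\<bar> = \<bar>A x - A y\<bar> * \<bar>k - (A x + A y) / C\<bar>"
    by (simp add: abs_mult)
  also have "\<dots> \<le> (La * \<bar>x - y\<bar>) * (k + 2 * B / C)"
  proof (rule mult_mono[OF A_diff])
    have "0 \<le> (A x + A y) / C" "(A x + A y) / C \<le> 2 * B / C"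
      using A_bound[OF x] A_bound[OF y] \<open>0 < C\<close> by (auto intro!: divide_right_mono)
    then show "\<bar>k - (A x + A y) / C\<bar> \<le> k + 2 * B / C" using \<open>0 \<le> k\<close> by linarith
  qed (use La0 in auto)
  finally show ?thesis by (simp add: La_def B_def mult_ac)
qed

text \<open>The antiderivative of the even function \<open>G \<bar>s\<bar>\<close> that vanishes at
  0 is odd, and on the half-line it has the derivative and initial value of \<open>q\<close>. This
  supplies the two-sided derivative at 0.\<close>

lemma odd_ode_extension:
  fixes q :: "real \<Rightarrow> real" and G :: "real \<Rightarrow> real"
  assumes cont: "continuous_on {0..} G" and "q 0 = 0"
    and q: "\<And>s. s \<ge> 0 \<Longrightarrow> (q has_real_derivative G s) (at s within {0..})"
  shows "\<exists>P. (\<forall>s. (P has_real_derivative G \<bar>s\<bar>) (at s)) \<and> (\<forall>s. P (- s) = - P s) \<and> (\<forall>s\<ge>0. P s = q s)"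
proof -
  have "continuous_on UNIV (G \<circ> abs)"
    by (intro continuous_on_compose continuous_on_subset[OF cont] continuous_intros) auto
  then have "isCont (\<lambda>s. G \<bar>s\<bar>) s" for s
    by (simp add: continuous_on_eq_continuous_at o_def)
  then obtain F where "\<And>s. (F has_vector_derivative G \<bar>s\<bar>) (at s)"
    using einterval_antiderivative[of "-\<infinity>" "\<infinity>" "\<lambda>s. G \<bar>s\<bar>"] by auto
  then have F: "(F has_real_derivative G \<bar>s\<bar>) (at s)" for s
    by (simp add: has_real_derivative_iff_has_vector_derivative)
  define P where "P s = F s - F 0" for s
  have P: "(P has_real_derivative G \<bar>s\<bar>) (at s)" for s
    unfolding P_def by (rule derivative_eq_intros F refl | simp)+
  have "P (- s) = - P s" for s
  proof -
    have "((\<lambda>s. P s + P (- s)) has_real_derivative 0) (at s)" for s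
      by (rule derivative_eq_intros P DERIV_chain2[OF P] refl | simp)+
    then have "P s + P (- s) = P 0 + P (- 0)" by (intro DERIV_isconst_all) auto
    then show ?thesis by (simp add: P_def)
  qed
  moreover have "P s = q s" if "s \<ge> 0" for s
  proof -
    have "\<exists>c. \<forall>s\<in>{0..}. P s - q s = c"
    proof (rule has_field_derivative_zero_constant)
      fix t :: real assume "t \<in> {0..}"
      then have t: "t \<ge> 0" by simp
      show "((\<lambda>s. P s - q s) has_real_derivative 0) (at t within {0..})"
        using DERIV_diff[OF has_field_derivative_at_within[OF P[of t]] q[OF t]] t by simp
    qed auto
    then have "P s - q s = P 0 - q 0" using that by auto
    then show ?thesis using \<open>q 0 = 0\<close> by (simp add: P_def)
  qed
  ultimately show ?thesis using P by blast
qed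

section \<open>Barriers and the global solution of the first order equation\<close>

text \<open>The left side of \<open>lower\<close> is the derivative of \<open>lo\<close> and the
  right side of \<open>upper\<close> that of \<open>hi\<close>, so these are a subsolution and a
  supersolution for \<open>\<sigma> * x\<close>; the factor \<open>\<sigma>\<close> lets one
  argument serve both \<open>C > 1 / k\<close> and \<open>C < 1 / k\<close>. \<open>\<nu>_le\<close>
  orders the two curves, and for \<open>\<sigma> = 1\<close> the bound \<open>\<mu>_le\<close> keeps
  \<open>1 - s * x\<close> positive up to the upper one.\<close>

locale slope_barriers =
  fixes k C \<sigma> \<nu> \<mu> \<epsilon> :: real
  assumes k: "1 \<le> k" and C: "0 < C" and \<sigma>: "\<sigma> = 1 \<or> \<sigma> = -1" and \<epsilon>: "0 < \<epsilon>" and \<nu>: "0 < \<nu>"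
    and \<nu>_le: "\<nu> \<le> \<mu>" "\<nu> * \<epsilon> \<le> \<mu>" and \<mu>_le: "\<sigma> * \<mu> \<le> \<epsilon>"
    and sign: "0 < \<sigma> * (k * C - 1)"
    and lower: "0 \<le> s \<Longrightarrow>
      \<nu> * (1 - s\<^sup>2) / (1 + s\<^sup>2)\<^sup>2 \<le> \<sigma> * slope_field k C s (\<sigma> * (\<nu> * s / (1 + s\<^sup>2)))"
    and upper: "0 \<le> s \<Longrightarrow>
      \<sigma> * slope_field k C s (\<sigma> * (\<mu> * s / (1 + \<epsilon> * s\<^sup>2))) \<le> \<mu> * (1 - \<epsilon> * s\<^sup>2) / (1 + \<epsilon> * s\<^sup>2)\<^sup>2"
begin

definition lo :: "real \<Rightarrow> real" where "lo s = \<nu> * s / (1 + s\<^sup>2)"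
definition hi :: "real \<Rightarrow> real" where "hi s = \<mu> * s / (1 + \<epsilon> * s\<^sup>2)"

lemma \<mu>: "0 < \<mu>" using \<nu> \<nu>_le by simp

lemma pos_den: "0 < 1 + \<epsilon> * s\<^sup>2" "0 < 1 + s\<^sup>2"
  using \<epsilon> by (auto intro: add_pos_nonneg)

lemma lo_nonneg: "0 \<le> s \<Longrightarrow> 0 \<le> lo s"
  using \<nu> pos_den by (simp add: lo_def less_imp_le)

lemma lo_le_hi: assumes "0 \<le> s" shows "lo s \<le> hi s"
proof -
  have "(\<nu> * \<epsilon>) * s\<^sup>2 \<le> \<mu> * s\<^sup>2" using \<nu>_le by (intro mult_right_mono) auto
  then have "\<nu> * (1 + \<epsilon> * s\<^sup>2) \<le> \<mu> * (1 + s\<^sup>2)" using \<nu>_le(1) by (simp add: algebra_simps)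
  then have "\<nu> / (1 + s\<^sup>2) \<le> \<mu> / (1 + \<epsilon> * s\<^sup>2)"
    using pos_den[of s] by (simp add: divide_simps)
  then have "s * (\<nu> / (1 + s\<^sup>2)) \<le> s * (\<mu> / (1 + \<epsilon> * s\<^sup>2))"
    using assms by (rule mult_left_mono)
  then show ?thesis by (simp add: lo_def hi_def mult_ac)
qed

lemma lo_deriv: "(lo has_real_derivative \<nu> * (1 - s\<^sup>2) / (1 + s\<^sup>2)\<^sup>2) (at s within T)"
  unfolding lo_def using pos_den[of s]
  by (auto intro!: derivative_eq_intros simp: field_simps power2_eq_square)

lemma hi_deriv: "(hi has_real_derivative \<mu> * (1 - \<epsilon> * s\<^sup>2) / (1 + \<epsilon> * s\<^sup>2)\<^sup>2) (at s within T)"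
  unfolding hi_def using pos_den[of s]
  by (auto intro!: derivative_eq_intros simp: field_simps power2_eq_square)

lemma hi_le: assumes "0 \<le> s" shows "hi s \<le> \<mu> * s" "s * hi s \<le> \<mu> / \<epsilon>"
proof -
  have "1 \<le> 1 + \<epsilon> * s\<^sup>2" using \<epsilon> by simp
  then have "\<mu> * s / (1 + \<epsilon> * s\<^sup>2) \<le> \<mu> * s / 1"
    using \<mu> assms pos_den[of s] by (intro divide_left_mono) auto
  then show "hi s \<le> \<mu> * s" by (simp add: hi_def)
  show "s * hi s \<le> \<mu> / \<epsilon>"
    unfolding hi_def using pos_den[of s] \<epsilon> \<mu> by (simp add: field_simps power2_eq_square)
qed

text \<open>For \<open>\<sigma> = 1\<close>, \<open>1 - s * hi s = (1 + (\<epsilon> - \<mu>) *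
  s\<^sup>2) / (1 + \<epsilon> * s\<^sup>2)\<close> with \<open>\<mu> \<le> \<epsilon>\<close>; for
  \<open>\<sigma> = -1\<close> the product \<open>s * x\<close> is added instead of subtracted. The
  lower bound keeps the field away from its singularity; the upper one later yields the growth of
  \<open>\<rho>\<close>.\<close>

lemma den_bounds:
  assumes "0 \<le> s" "0 \<le> x" "x \<le> hi s"
  shows "1 / (1 + \<epsilon> * s\<^sup>2) \<le> 1 - s * (\<sigma> * x)" "1 - s * (\<sigma> * x) \<le> 1 + \<mu> / \<epsilon>"
proof -
  have sx: "0 \<le> s * x" "s * x \<le> s * hi s" using assms by (auto intro: mult_left_mono)
  show "1 / (1 + \<epsilon> * s\<^sup>2) \<le> 1 - s * (\<sigma> * x)"
  proof (cases "\<sigma> = 1")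
    case True
    have "\<mu> * s\<^sup>2 \<le> \<epsilon> * s\<^sup>2" using \<mu>_le True by (intro mult_right_mono) auto
    then have "1 / (1 + \<epsilon> * s\<^sup>2) \<le> 1 - s * hi s"
      unfolding hi_def using pos_den[of s] by (simp add: field_simps power2_eq_square)
    then show ?thesis using sx True by simp
  next
    case False
    have "1 / (1 + \<epsilon> * s\<^sup>2) \<le> 1" using \<epsilon> pos_den[of s] by simp
    then show ?thesis using sx False \<sigma> by auto
  qed
  have "0 < \<mu> / \<epsilon>" using \<mu> \<epsilon> by simp
  then show "1 - s * (\<sigma> * x) \<le> 1 + \<mu> / \<epsilon>"
    using sx hi_le(2)[OF assms(1)] \<sigma> by auto
qed

text \<open>The equation with \<open>x\<close> clamped between the barriers has a global solution
  \<open>q\<close>. Where \<open>q\<close> exceeds \<open>hi\<close>, its derivative is the field on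
  \<open>hi\<close>, so by \<open>upper\<close> the excess cannot grow; likewise below
  \<open>lo\<close>. Hence the clamp never acts and \<open>q\<close> solves the original
  equation.\<close>

lemma slope_solution_halfline:
  "\<exists>q. q 0 = 0 \<and> (\<forall>s\<ge>0. (q has_real_derivative \<sigma> * slope_field k C s (\<sigma> * q s)) (at s within {0..})
     \<and> lo s \<le> q s \<and> q s \<le> hi s)"
proof -
  define cl where "cl s x = max (lo s) (min x (hi s))" for s x
  have cl: "lo s \<le> cl s x" "cl s x \<le> hi s" "0 \<le> cl s x" if "0 \<le> s" for s x
    using lo_le_hi[OF that] lo_nonneg[OF that] by (auto simp: cl_def)
  have cl_lip: "\<bar>cl s x - cl s y\<bar> \<le> \<bar>x - y\<bar>" for s x y
    unfolding cl_def by linarith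
  have den: "0 < 1 - s * (\<sigma> * cl s x)" if "0 \<le> s" for s x
    by (rule less_le_trans[OF _ den_bounds(1)]) (use that cl pos_den[of s] in auto)
  have lo_cont: "continuous_on T (\<lambda>z. lo (fst z))" and hi_cont: "continuous_on T (\<lambda>z. hi (fst z))" for T
    unfolding lo_def hi_def using pos_den by (auto intro!: continuous_intros simp: less_imp_neq[THEN not_sym])
  have "\<exists>q. q 0 = 0 \<and> (\<forall>s\<ge>0. (q has_real_derivative \<sigma> * slope_field k C s (\<sigma> * cl s (q s))) (at s within {0..}))"
  proof (rule picard_halfline)
    show "continuous_on ({0..} \<times> UNIV) (\<lambda>(s, x). \<sigma> * slope_field k C s (\<sigma> * cl s x))"
      unfolding case_prod_unfold
    proof (intro continuous_on_mult_left slope_field_continuous)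
      show "continuous_on ({0..} \<times> UNIV) (\<lambda>z. cl (fst z) (snd z))"
        unfolding cl_def by (intro continuous_intros lo_cont hi_cont)
      show "1 - fst z * (\<sigma> * cl (fst z) (snd z)) \<noteq> 0" if "z \<in> {0..} \<times> UNIV" for z
        using den[of "fst z" "snd z"] that by auto
    qed (use C in \<open>simp_all add: continuous_on_fst\<close>)
    show "\<exists>L. \<forall>s\<in>{0..S}. \<forall>x y. \<bar>\<sigma> * slope_field k C s (\<sigma> * cl s x) - \<sigma> * slope_field k C s (\<sigma> * cl s y)\<bar> \<le> L * \<bar>x - y\<bar>" for S
    proof (cases "0 \<le> S")
      case True
      \<comment> \<open>For times up to \<open>S\<close>, \<open>M\<close> bounds the clamped values
        since \<open>hi s \<le> \<mu> * s\<close>, and \<open>m\<close> is the bound of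
        \<open>den_bounds\<close> at \<open>S\<close>, the smallest on the interval.\<close>
      define M where "M = \<mu> * S"
      define m where "m = 1 / (1 + \<epsilon> * S\<^sup>2)"
      define L where "L = (2 * M * (1 + S * M) + S * (1 + M\<^sup>2)) / m\<^sup>2 * (k + 2 * ((1 + M\<^sup>2) / m) / C)"
      have M0: "0 \<le> M" and m0: "0 < m" using True \<mu> pos_den[of S] by (auto simp: M_def m_def)
      have L0: "0 \<le> L" unfolding L_def using True M0 m0 k C by (intro mult_nonneg_nonneg divide_nonneg_nonneg add_nonneg_nonneg) auto
      have "\<bar>\<sigma> * slope_field k C s (\<sigma> * cl s x) - \<sigma> * slope_field k C s (\<sigma> * cl s y)\<bar> \<le> L * \<bar>x - y\<bar>"
        if s: "s \<in> {0..S}" for s x y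
      proof -
        have b: "\<bar>\<sigma> * cl s z\<bar> \<le> M \<and> m \<le> 1 - s * (\<sigma> * cl s z)" for z
        proof
          have "\<bar>\<sigma> * cl s z\<bar> = cl s z" using \<sigma> cl[of s z] s by (auto simp: abs_mult)
          also have "\<dots> \<le> \<mu> * s" using cl[of s z] hi_le(1)[of s] s by auto
          also have "\<dots> \<le> M" using s \<mu> by (simp add: M_def)
          finally show "\<bar>\<sigma> * cl s z\<bar> \<le> M" .
          have "m \<le> 1 / (1 + \<epsilon> * s\<^sup>2)"
            unfolding m_def using s \<epsilon> pos_den[of s] pos_den[of S]
            by (intro divide_left_mono add_left_mono mult_left_mono power_mono) auto
          also have "\<dots> \<le> 1 - s * (\<sigma> * cl s z)" using s cl by (intro den_bounds) auto
          finally show "m \<le> 1 - s * (\<sigma> * cl s z)" .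
        qed
        have "\<bar>\<sigma> * slope_field k C s (\<sigma> * cl s x) - \<sigma> * slope_field k C s (\<sigma> * cl s y)\<bar>
            = \<bar>slope_field k C s (\<sigma> * cl s x) - slope_field k C s (\<sigma> * cl s y)\<bar>"
          using \<sigma> by auto
        also have "\<dots> \<le> L * \<bar>\<sigma> * cl s x - \<sigma> * cl s y\<bar>"
          unfolding L_def by (rule slope_field_lipschitz) (use b k C m0 M0 s in auto)
        also have "\<dots> = L * \<bar>cl s x - cl s y\<bar>" using \<sigma> by auto
        also have "\<dots> \<le> L * \<bar>x - y\<bar>" by (intro mult_left_mono cl_lip L0)
        finally show ?thesis .
      qed
      then show ?thesis by blast
    qed auto
  qed
  then obtain q where q0: "q 0 = 0" and
    q: "\<And>s. s \<ge> 0 \<Longrightarrow> (q has_real_derivative \<sigma> * slope_field k C s (\<sigma> * cl s (q s))) (at s within {0..})"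
    by blast
  have hi: "q s - hi s \<le> 0" if "s \<ge> 0" for s
  proof (rule stays_nonpos[where d = "\<lambda>s. q s - hi s", OF DERIV_diff[OF q hi_deriv]])
    fix t assume t: "0 < t" "0 < q t - hi t"
    then have "cl t (q t) = hi t" using lo_le_hi[of t] by (auto simp: cl_def)
    then show "\<sigma> * slope_field k C t (\<sigma> * cl t (q t)) - \<mu> * (1 - \<epsilon> * t\<^sup>2) / (1 + \<epsilon> * t\<^sup>2)\<^sup>2 \<le> 0"
      using upper[of t] t by (simp add: hi_def)
  qed (use that q0 in \<open>auto simp: hi_def\<close>)
  have lo: "lo s - q s \<le> 0" if "s \<ge> 0" for s
  proof (rule stays_nonpos[where d = "\<lambda>s. lo s - q s", OF DERIV_diff[OF lo_deriv q]])
    fix t assume t: "0 < t" "0 < lo t - q t"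
    then have "cl t (q t) = lo t" using lo_le_hi[of t] by (auto simp: cl_def)
    then show "\<nu> * (1 - t\<^sup>2) / (1 + t\<^sup>2)\<^sup>2 - \<sigma> * slope_field k C t (\<sigma> * cl t (q t)) \<le> 0"
      using lower[of t] t by (simp add: lo_def)
  qed (use that q0 in \<open>auto simp: lo_def\<close>)
  have "(q has_real_derivative \<sigma> * slope_field k C s (\<sigma> * q s)) (at s within {0..})
      \<and> lo s \<le> q s \<and> q s \<le> hi s" if "s \<ge> 0" for s
  proof -
    have "cl s (q s) = q s" using lo[OF that] hi[OF that] by (auto simp: cl_def)
    then show ?thesis using q[OF that] lo[OF that] hi[OF that] by simp
  qed
  then show ?thesis using q0 by blast
qed

text \<open>The field is invariant under \<open>(s, x) \<mapsto> (- s, - x)\<close>, so the odd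
  extension of the half-line solution solves the equation everywhere.\<close>

lemma slope_solution:
  "\<exists>P. (\<forall>s. (P has_real_derivative slope_field k C s (P s)) (at s)) \<and> (\<forall>s. P (- s) = - P s)
     \<and> (\<forall>s\<ge>0. lo s \<le> \<sigma> * P s \<and> \<sigma> * P s \<le> hi s)"
proof -
  obtain q where q0: "q 0 = 0"
    and q: "\<And>s. s \<ge> 0 \<Longrightarrow> (q has_real_derivative \<sigma> * slope_field k C s (\<sigma> * q s)) (at s within {0..})"
    and b: "\<And>s. s \<ge> 0 \<Longrightarrow> lo s \<le> q s \<and> q s \<le> hi s"
    using slope_solution_halfline by blast
  have \<sigma>\<sigma>: "\<sigma> * (\<sigma> * x) = x" for x using \<sigma> by auto
  have den: "1 - s * (\<sigma> * q s) \<noteq> 0" if "s \<ge> 0" for s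
    using den_bounds(1)[of s "q s"] b[OF that] lo_nonneg[OF that] that pos_den[of s]
    by (metis divide_pos_pos less_le_trans less_irrefl order_trans zero_less_one)
  have "continuous_on {0..} q"
    by (rule DERIV_continuous_on) (use q in auto)
  then have cont: "continuous_on {0..} (\<lambda>s. slope_field k C s (\<sigma> * q s))"
    using den C by (intro slope_field_continuous continuous_intros) auto
  have "\<exists>P. (\<forall>s. (P has_real_derivative slope_field k C \<bar>s\<bar> (\<sigma> * q \<bar>s\<bar>)) (at s)) \<and> (\<forall>s. P (- s) = - P s) \<and> (\<forall>s\<ge>0. P s = \<sigma> * q s)"
    by (rule odd_ode_extension[OF cont]) (use q0 DERIV_cmult[OF q, of _ \<sigma>] in \<open>auto simp: \<sigma>\<sigma>\<close>)
  then obtain P where P: "\<And>s. (P has_real_derivative slope_field k C \<bar>s\<bar> (\<sigma> * q \<bar>s\<bar>)) (at s)"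
    and odd: "\<And>s. P (- s) = - P s" and eq: "\<And>s. s \<ge> 0 \<Longrightarrow> P s = \<sigma> * q s" by blast
  have "slope_field k C \<bar>s\<bar> (\<sigma> * q \<bar>s\<bar>) = slope_field k C s (P s)" for s
    using eq[of "\<bar>s\<bar>"] odd[of s] slope_field_uminus[of k C s "P s"] by (cases "s \<ge> 0") auto
  then show ?thesis using P odd eq b by (metis \<sigma>\<sigma>)
qed

end

subsection \<open>The profile curve\<close>

text \<open>Every zero is a strict downward crossing. After the first zero \<open>z\<close> the
  function is negative; a return to a nonnegative value would produce a next zero reached from
  below, where the derivative could not be negative.\<close>

lemma single_sign_change:
  fixes g g' :: "real \<Rightarrow> real"
  assumes der: "\<And>s. s \<ge> 0 \<Longrightarrow> (g has_real_derivative g' s) (at s)"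
    and "0 < g 0" and cross: "\<And>s. s > 0 \<Longrightarrow> g s = 0 \<Longrightarrow> g' s < 0"
    and ex: "\<exists>s>0. g s \<le> 0"
  shows "\<exists>z>0. \<forall>s\<ge>0. sgn (g s) = sgn (z - s)"
proof -
  have cont: "continuous_on {a..b} g" if "0 \<le> a" for a b
    by (rule DERIV_continuous_on[where D = g']) (use that in \<open>auto intro!: has_field_derivative_at_within der\<close>)
  \<comment> \<open>The factor \<open>c\<close> is 1 for the first zero after a positive value and
    -1 for the first zero after a negative one.\<close>
  have first_zero: "\<exists>w>a. w \<le> b \<and> g w = 0 \<and> (\<forall>t. a \<le> t \<and> t < w \<longrightarrow> c * g t > 0)"
    if ab: "0 \<le> a" "a \<le> b" and ga: "c * g a > 0" and gb: "c * g b \<le> 0" for a b c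
  proof -
    let ?Z = "{a..b} \<inter> (\<lambda>t. c * g t) -` {..0}"
    have "closed ?Z" using cont[OF ab(1), of b] by (intro continuous_closed_preimage continuous_intros) auto
    then have "compact ?Z" by (metis bounded_Int bounded_closed_interval compact_eq_bounded_closed)
    moreover have "?Z \<noteq> {}" using ab gb by force
    ultimately have "\<exists>w\<in>?Z. \<forall>y\<in>?Z. w \<le> y" by (rule compact_attains_inf)
    then obtain w where w: "w \<in> ?Z" "\<And>y. y \<in> ?Z \<Longrightarrow> w \<le> y" by blast
    have "\<exists>y\<ge>a. y \<le> w \<and> c * g y = 0"
      by (rule IVT2') (use w ga cont[OF ab(1), of w] in \<open>auto intro!: continuous_intros\<close>)
    then obtain y where y: "a \<le> y" "y \<le> w" "c * g y = 0" by blast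
    then have "y \<in> ?Z" using w(1) by auto
    then have "y = w" using w(2)[of y] y by simp
    then have cw: "c * g w = 0" using y by simp
    then have "g w = 0" "a < w" using ga w(1) by (auto simp: less_le)
    moreover have "c * g t > 0" if "a \<le> t" "t < w" for t
      using w(2)[of t] that w(1) by (auto simp: not_le[symmetric])
    ultimately show ?thesis using w(1) by auto
  qed
  obtain b where "b > 0" "g b \<le> 0" using ex by blast
  then obtain z where z: "z > 0" "g z = 0" "\<And>t. 0 \<le> t \<Longrightarrow> t < z \<Longrightarrow> g t > 0"
    using first_zero[of 0 b 1] \<open>0 < g 0\<close> by auto
  have neg: "g s < 0" if "s > z" for s
  proof (rule ccontr)
    assume s: "\<not> g s < 0"
    have "g' z < 0" using cross z by auto
    then obtain e where e: "e > 0" "\<And>h. 0 < h \<Longrightarrow> h < e \<Longrightarrow> g (z + h) < g z"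
      using DERIV_neg_dec_right[OF der[of z]] z by force
    \<comment> \<open>Halving keeps \<open>y\<close> strictly between \<open>z\<close> and
      \<open>s\<close> and within the range where \<open>g\<close> lies below
      \<open>g z = 0\<close>, so the search for the next zero starts from a negative value.\<close>
    define y where "y = z + min e (s - z) / 2"
    have y: "z < y" "y < s" using e(1) that by (auto simp: y_def min_def field_simps)
    have gy: "g y < 0"
      using e(2)[of "min e (s - z) / 2"] e(1) that z(2) by (auto simp: y_def min_def)
    obtain w where w: "w > y" "g w = 0" "\<And>t. y \<le> t \<Longrightarrow> t < w \<Longrightarrow> g t < 0"
      using first_zero[of y s "-1"] y z(1) gy s by auto
    have "g' w < 0" using cross w y z by auto
    then obtain e' where e': "e' > 0" "\<And>h. 0 < h \<Longrightarrow> h < e' \<Longrightarrow> g w < g (w - h)"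
      using DERIV_neg_dec_left[OF der[of w]] w y z by force
    have "g w < g (w - min e' (w - y) / 2)"
      by (rule e'(2)) (use e'(1) w in \<open>auto simp: min_def\<close>)
    moreover have "g (w - min e' (w - y) / 2) < 0"
      by (rule w(3)) (use e'(1) w in \<open>auto simp: min_def field_simps\<close>)
    ultimately show False using w(2) by simp
  qed
  have "sgn (g s) = sgn (z - s)" if "s \<ge> 0" for s
    using z(3)[OF that] neg[of s] z(2) by (cases s z rule: linorder_cases) auto
  then show ?thesis using z(1) by blast
qed

text \<open>\<open>P\<close> is the slope \<open>r'\<close> and \<open>\<rho>\<close> is
  \<open>ln (r / r0)\<close>, both as functions of \<open>s = h / r\<close>. Such functions are
  constructed in \<open>symmetric_expander_exists\<close>.\<close>

locale profile = slope_barriers +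
  fixes P \<rho> :: "real \<Rightarrow> real" and r0 :: real
  assumes r0: "0 < r0"
    and P_deriv: "\<And>s. (P has_real_derivative slope_field k C s (P s)) (at s)"
    and P_odd: "\<And>s. P (- s) = - P s"
    and P_bounds: "\<And>s. 0 \<le> s \<Longrightarrow> lo s \<le> \<sigma> * P s" "\<And>s. 0 \<le> s \<Longrightarrow> \<sigma> * P s \<le> hi s"
    and \<rho>_deriv: "\<And>s. (\<rho> has_real_derivative P s / (1 - s * P s)) (at s)"
    and \<rho>_0: "\<rho> 0 = 0" and \<rho>_even: "\<And>s. \<rho> (- s) = \<rho> s"
begin

lemma \<sigma>_cancel: "\<sigma> * (\<sigma> * x) = x" using \<sigma> by auto

lemma P_0: "P 0 = 0" using P_odd[of 0] by simp

lemma den_pos: "0 < 1 - s * P s" and den_le: "1 - s * P s \<le> 1 + \<mu> / \<epsilon>"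
proof -
  have *: "0 < 1 - s * P s \<and> 1 - s * P s \<le> 1 + \<mu> / \<epsilon>" if "0 \<le> s" for s
  proof -
    have "0 \<le> \<sigma> * P s" "\<sigma> * P s \<le> hi s"
      using P_bounds[OF that] lo_nonneg[OF that] by auto
    from den_bounds[OF that this] have "1 / (1 + \<epsilon> * s\<^sup>2) \<le> 1 - s * P s" "1 - s * P s \<le> 1 + \<mu> / \<epsilon>"
      by (simp_all add: \<sigma>_cancel)
    moreover have "0 < 1 / (1 + \<epsilon> * s\<^sup>2)" using pos_den[of s] by simp
    ultimately show ?thesis by linarith
  qed
  show "0 < 1 - s * P s" "1 - s * P s \<le> 1 + \<mu> / \<epsilon>"
    using *[of s] *[of "- s"] P_odd[of s] by (cases "0 \<le> s"; simp)+
qed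

definition N :: "real \<Rightarrow> real" where "N s = k * (1 - s * P s) - (1 + (P s)\<^sup>2) / C"

lemma slope_eq_N: "slope_field k C s (P s) = (1 + (P s)\<^sup>2) / (1 - s * P s)\<^sup>2 * N s"
  unfolding slope_field_def N_def using den_pos[of s] C by (simp add: field_simps power2_eq_square)

lemma sgn_slope: "sgn (slope_field k C s (P s)) = sgn (N s)"
proof -
  have "0 < (1 + (P s)\<^sup>2) / (1 - s * P s)\<^sup>2" using den_pos[of s] by (auto intro!: divide_pos_pos add_pos_nonneg)
  then show ?thesis unfolding slope_eq_N by (simp only: sgn_mult sgn_pos mult_1)
qed

lemma N_deriv: "(N has_real_derivative - k * (P s + s * slope_field k C s (P s)) - 2 * P s * slope_field k C s (P s) / C) (at s)"
  unfolding N_def[abs_def] using C by (auto intro!: derivative_eq_intros P_deriv simp: field_simps)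

lemma N_0: "0 < \<sigma> * N 0"
  using sign C by (simp add: N_def P_0 field_simps zero_less_mult_iff)

lemma N_even: "N (- s) = N s"
  by (simp add: N_def P_odd)

lemma \<sigma>P_nonneg: "0 \<le> s \<Longrightarrow> 0 \<le> \<sigma> * P s"
  using P_bounds(1) lo_nonneg by (meson order_trans)

text \<open>\<open>single_sign_change\<close> applies to \<open>\<sigma> * N\<close>: at a zero of
  \<open>N\<close> the field vanishes too, which leaves the derivative
  \<open>- k * (\<sigma> * P s) < 0\<close>. A zero must occur, for otherwise
  \<open>\<sigma> * P\<close> would be nondecreasing, against the decay that \<open>hi\<close>
  forces.\<close>

lemma slope_sign_change: "\<exists>z>0. \<forall>s. sgn (slope_field k C s (P s)) = \<sigma> * sgn (z - \<bar>s\<bar>)"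
proof -
  have "\<exists>z>0. \<forall>s\<ge>0. sgn (\<sigma> * N s) = sgn (z - s)"
  proof (rule single_sign_change[OF DERIV_cmult[OF N_deriv] N_0])
    fix s assume s: "0 < s" "\<sigma> * N s = 0"
    then have N: "N s = 0" using \<sigma> by auto
    then have f: "slope_field k C s (P s) = 0" by (simp add: slope_eq_N)
    have "P s \<noteq> 0"
    proof
      assume "P s = 0"
      then have "N s = N 0" by (simp add: N_def P_0)
      then show False using N N_0 by simp
    qed
    then have "0 < \<sigma> * P s" using \<sigma>P_nonneg[of s] s \<sigma> by (auto simp: less_le)
    then have "0 < k * (\<sigma> * P s)" using k by simp
    then show "\<sigma> * (- k * (P s + s * slope_field k C s (P s)) - 2 * P s * slope_field k C s (P s) / C) < 0"
      by (simp add: f mult_ac)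
  next
    show "\<exists>s>0. \<sigma> * N s \<le> 0"
    proof (rule ccontr)
      assume "\<not> ?thesis"
      then have pos: "\<sigma> * N s > 0" if "s > 0" for s using that by force
      \<comment> \<open>Chosen so that \<open>S * (\<nu> / 2)\<close> exceeds
        \<open>\<mu> / \<epsilon>\<close>; here \<open>\<nu> / 2\<close> is \<open>lo 1\<close> and
        \<open>\<mu> / \<epsilon>\<close> bounds \<open>s * hi s\<close>.\<close>
      define S where "S = 1 + 2 * \<mu> / (\<epsilon> * \<nu>)"
      have S: "1 < S" using \<mu> \<epsilon> \<nu> by (simp add: S_def)
      have "- (\<sigma> * P S) \<le> - (\<sigma> * P 1)"
      proof (rule nonincreasing_within[where d = "\<lambda>s. - (\<sigma> * P s)"])
        show "((\<lambda>s. - (\<sigma> * P s)) has_real_derivative - (\<sigma> * slope_field k C s (P s))) (at s within {1..S})" for s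
          by (rule has_field_derivative_at_within[OF DERIV_minus[OF DERIV_cmult[OF P_deriv]]])
        show "- (\<sigma> * slope_field k C s (P s)) \<le> 0" if "s \<in> {1<..<S}" for s
        proof -
          have "\<sigma> * slope_field k C s (P s) = (1 + (P s)\<^sup>2) / (1 - s * P s)\<^sup>2 * (\<sigma> * N s)"
            by (simp add: slope_eq_N)
          moreover have "0 \<le> \<sigma> * N s" using pos[of s] that by auto
          ultimately show ?thesis by simp
        qed
      qed (use S in simp)
      moreover have "\<nu> / 2 \<le> \<sigma> * P 1" using P_bounds(1)[of 1] by (simp add: lo_def)
      moreover have "S * (\<sigma> * P S) \<le> \<mu> / \<epsilon>"
        using order_trans[OF mult_left_mono[OF P_bounds(2)[of S], of S] hi_le(2)[of S]] S by simp
      ultimately have "S * (\<nu> / 2) \<le> \<mu> / \<epsilon>"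
        using S by (smt (verit) mult_left_mono)
      moreover have "S * (\<nu> / 2) = \<nu> / 2 + \<mu> / \<epsilon>"
        using \<epsilon> \<nu> by (simp add: S_def field_simps)
      ultimately show False using \<nu> by simp
    qed
  qed
  then obtain z where z: "z > 0" "\<And>s. s \<ge> 0 \<Longrightarrow> sgn (\<sigma> * N s) = sgn (z - s)" by blast
  have "sgn (slope_field k C s (P s)) = \<sigma> * sgn (z - \<bar>s\<bar>)" for s
  proof -
    have "N s = N \<bar>s\<bar>" using N_even[of s] by (cases "s \<ge> 0") auto
    then have "\<sigma> * sgn (z - \<bar>s\<bar>) = \<sigma> * sgn (\<sigma> * N s)" using z(2)[of "\<bar>s\<bar>"] by simp
    also have "\<dots> = sgn (N s)" using \<sigma> by auto
    finally show ?thesis by (simp add: sgn_slope)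
  qed
  then show ?thesis using z(1) by blast
qed

section \<open>Growth and decay of the logarithm of the radius\<close>

text \<open>The derivative of \<open>\<sigma> * \<rho>\<close> is at least
  \<open>lo s / (1 + \<mu> / \<epsilon>)\<close>, a multiple of the derivative of
  \<open>ln (1 + s\<^sup>2)\<close>. This gives both the extremum at 0 and the limit at
  infinity.\<close>

lemma \<rho>_growth:
  assumes "0 \<le> s"
  shows "\<epsilon> * \<nu> / (2 * (\<epsilon> + \<mu>)) * ln (1 + s\<^sup>2) \<le> \<sigma> * \<rho> s"
proof -
  let ?c = "\<epsilon> * \<nu> / (2 * (\<epsilon> + \<mu>))"
  have "?c * ln (1 + s\<^sup>2) - \<sigma> * \<rho> s \<le> ?c * ln (1 + 0\<^sup>2) - \<sigma> * \<rho> 0"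
  proof (rule nonincreasing_within[where d = "\<lambda>t. ?c * ln (1 + t\<^sup>2) - \<sigma> * \<rho> t"])
    fix t assume "t \<in> {0..s}"
    show "((\<lambda>t. ?c * ln (1 + t\<^sup>2) - \<sigma> * \<rho> t) has_real_derivative
        ?c * (2 * t / (1 + t\<^sup>2)) - \<sigma> * (P t / (1 - t * P t))) (at t within {0..s})"
    proof (intro DERIV_diff DERIV_cmult has_field_derivative_at_within[OF \<rho>_deriv])
      show "((\<lambda>t. ln (1 + t\<^sup>2)) has_real_derivative 2 * t / (1 + t\<^sup>2)) (at t within {0..s})"
        using pos_den(2)[of t] by (auto intro!: derivative_eq_intros)
    qed
  next
    fix t assume "t \<in> {0<..<s}"
    then have t: "0 < t" by simp
    have "?c * (2 * t / (1 + t\<^sup>2)) = lo t / (1 + \<mu> / \<epsilon>)"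
      unfolding lo_def using \<epsilon> \<mu> pos_den(2)[of t] by (simp add: divide_simps)
    also have "\<dots> \<le> \<sigma> * P t / (1 - t * P t)"
      using P_bounds(1)[of t] lo_nonneg[of t] den_pos[of t] den_le[of t] t by (intro frac_le) auto
    finally show "?c * (2 * t / (1 + t\<^sup>2)) - \<sigma> * (P t / (1 - t * P t)) \<le> 0" by simp
  qed (use assms in auto)
  then show ?thesis using \<rho>_0 by simp
qed

text \<open>The radius decays at most like a power of \<open>s\<close> with exponent
  \<open>\<mu> / (\<epsilon> + \<mu>) < 1\<close>, so \<open>s\<close> times the radius is still
  unbounded. The critical case is \<open>\<sigma> = -1\<close>, where the barrier \<open>hi\<close>
  bounds the decay rate.\<close>

lemma \<rho>_lower:
  assumes "0 \<le> s"
  shows "- (\<mu> / (2 * (\<epsilon> + \<mu>))) * ln (1 + (\<epsilon> + \<mu>) * s\<^sup>2) \<le> \<rho> s"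
proof -
  define a where "a = \<epsilon> + \<mu>"
  have a: "0 < a" using \<epsilon> \<mu> by (simp add: a_def)
  have pos: "0 < 1 + a * t\<^sup>2" for t using a by (auto intro: add_pos_nonneg)
  let ?c = "- (\<mu> / (2 * a))"
  have "?c * ln (1 + a * s\<^sup>2) - \<rho> s \<le> ?c * ln (1 + a * 0\<^sup>2) - \<rho> 0"
  proof (rule nonincreasing_within[where d = "\<lambda>t. ?c * ln (1 + a * t\<^sup>2) - \<rho> t"])
    fix t assume "t \<in> {0..s}"
    show "((\<lambda>t. ?c * ln (1 + a * t\<^sup>2) - \<rho> t) has_real_derivative
        ?c * (2 * a * t / (1 + a * t\<^sup>2)) - P t / (1 - t * P t)) (at t within {0..s})"
      using pos[of t]
      by (auto intro!: derivative_eq_intros has_field_derivative_at_within[OF \<rho>_deriv])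
  next
    fix t assume "t \<in> {0<..<s}"
    then have t: "0 < t" by simp
    have c: "?c * (2 * a * t / (1 + a * t\<^sup>2)) = - (\<mu> * t / (1 + a * t\<^sup>2))" using a by simp
    show "?c * (2 * a * t / (1 + a * t\<^sup>2)) - P t / (1 - t * P t) \<le> 0"
    proof (cases "\<sigma> = 1")
      case True
      then have "0 \<le> P t / (1 - t * P t)" using \<sigma>P_nonneg[of t] t den_pos[of t] by simp
      moreover have "0 \<le> \<mu> * t / (1 + a * t\<^sup>2)" using \<mu> t pos[of t] by simp
      ultimately show ?thesis unfolding c by linarith
    next
      case False
      then have x: "0 \<le> - P t" "- P t \<le> hi t" using \<sigma>P_nonneg[of t] P_bounds(2)[of t] t \<sigma> by auto
      have h: "0 \<le> hi t" using x by simp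
      \<comment> \<open>Monotonicity of \<open>y / (1 + t * y)\<close> in \<open>y\<close>,
        cross-multiplied, for \<open>- P t \<le> hi t\<close>.\<close>
      have "- P t * (1 + t * hi t) \<le> hi t * (1 - t * P t)"
        using x t by (simp add: algebra_simps)
      then have "- P t / (1 - t * P t) \<le> hi t / (1 + t * hi t)"
        using den_pos[of t] h t by (simp add: divide_simps add_pos_nonneg split: if_splits)
      also have "\<dots> = \<mu> * t / (1 + a * t\<^sup>2)"
      proof -
        have "1 + t * hi t = (1 + a * t\<^sup>2) / (1 + \<epsilon> * t\<^sup>2)"
          unfolding hi_def a_def using pos_den(1)[of t] by (simp add: field_simps power2_eq_square)
        then show ?thesis using pos_den(1)[of t] by (simp add: hi_def)
      qed
      finally show ?thesis unfolding c by simp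
    qed
  qed (use assms in auto)
  then show ?thesis using \<rho>_0 by (simp add: a_def)
qed

section \<open>The curve parametrized by \<open>s\<close>, and inversion of its height\<close>

definition radius :: "real \<Rightarrow> real" where "radius s = r0 * exp (\<rho> s)"
definition height :: "real \<Rightarrow> real" where "height s = s * radius s"

lemma radius_pos: "0 < radius s" using r0 by (simp add: radius_def)

lemma radius_deriv: "(radius has_real_derivative radius s * (P s / (1 - s * P s))) (at s)"
  unfolding radius_def by (auto intro!: derivative_eq_intros \<rho>_deriv)

lemma height_deriv: "(height has_real_derivative radius s / (1 - s * P s)) (at s)"
  unfolding height_def[abs_def]
  using den_pos[of s] by (auto intro!: derivative_eq_intros radius_deriv simp: field_simps)

lemma height_mono: "strict_mono height"
proof (rule strict_monoI)
  fix x y :: real assume "x < y"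
  then show "height x < height y"
    by (rule DERIV_pos_imp_increasing) (use height_deriv radius_pos den_pos in \<open>blast intro: divide_pos_pos\<close>)
qed

lemma height_odd: "height (- s) = - height s"
  by (simp add: height_def radius_def \<rho>_even)

text \<open>By \<open>\<rho>_lower\<close>, for \<open>s \<ge> 1\<close> the height is at least a
  positive constant times the power of \<open>s\<close> with exponent \<open>1 - 2 * b\<close>,
  which is positive because \<open>\<epsilon> > 0\<close>. Together with monotonicity this makes the
  solution exist for all \<open>h\<close>.\<close>

lemma height_at_top: "filterlim height at_top at_top"
proof -
  define a where "a = \<epsilon> + \<mu>"
  define b where "b = \<mu> / (2 * a)"
  have a: "0 < a" and b: "0 < b" "b < 1 / 2" using \<epsilon> \<mu> by (auto simp: a_def b_def field_simps)
  have "filterlim (\<lambda>s. r0 * exp (- b * ln (1 + a) + (1 - 2 * b) * ln s)) at_top at_top"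
  proof -
    have "filterlim (\<lambda>s. - b * ln (1 + a) + (1 - 2 * b) * ln s) at_top at_top"
      using b by (intro filterlim_tendsto_add_at_top[OF tendsto_const] filterlim_tendsto_pos_mult_at_top[OF tendsto_const] ln_at_top) auto
    then show ?thesis
      using r0 by (intro filterlim_tendsto_pos_mult_at_top[OF tendsto_const] filterlim_compose[OF exp_at_top])
  qed
  then show ?thesis
  proof (rule filterlim_at_top_mono)
    show "eventually (\<lambda>s. r0 * exp (- b * ln (1 + a) + (1 - 2 * b) * ln s) \<le> height s) at_top"
      using eventually_ge_at_top[of 1]
    proof eventually_elim
      case (elim s)
      have "1 + a * s\<^sup>2 \<le> (1 + a) * s\<^sup>2" using elim by (simp add: algebra_simps)
      then have "ln (1 + a * s\<^sup>2) \<le> ln ((1 + a) * s\<^sup>2)"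
        using a by (subst ln_le_cancel_iff) (use elim in \<open>auto intro!: add_pos_nonneg mult_pos_pos\<close>)
      also have "\<dots> = ln (1 + a) + 2 * ln s" using a elim by (simp add: ln_mult ln_realpow)
      finally have "b * ln (1 + a * s\<^sup>2) \<le> b * (ln (1 + a) + 2 * ln s)" using b by simp
      moreover have "- b * ln (1 + a * s\<^sup>2) \<le> \<rho> s"
        using \<rho>_lower[of s] elim by (simp add: a_def b_def)
      ultimately have "- b * ln (1 + a) + (1 - 2 * b) * ln s \<le> ln s + \<rho> s" by (simp add: algebra_simps)
      then have "exp (- b * ln (1 + a) + (1 - 2 * b) * ln s) \<le> s * exp (\<rho> s)"
        using elim by (metis exp_add exp_le_cancel_iff exp_ln less_le_trans zero_less_one)
      then show ?case using r0 by (simp add: height_def radius_def)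
    qed
  qed
qed

lemma height_bij: "bij height"
proof -
  have cont: "isCont height s" for s by (rule DERIV_isCont[OF height_deriv])
  have "\<exists>s. height s = h" if h: "0 \<le> h" for h
  proof -
    obtain s where s: "s \<ge> 0" "height s \<ge> h"
      using height_at_top unfolding filterlim_at_top by (metis eventually_at_top_linorder linear)
    have "\<exists>x\<ge>0. x \<le> s \<and> height x = h"
      by (rule IVT) (use s h cont in \<open>auto simp: height_def[of 0]\<close>)
    then show ?thesis by blast
  qed
  then have "\<exists>s. height s = h" for h
    by (cases "0 \<le> h") (auto, metis height_odd minus_minus neg_0_le_iff_le linear)
  then have "surj height" by (metis surjI surj_def)
  then show ?thesis using height_mono by (simp add: bij_def strict_mono_imp_inj_on)
qed

text \<open>Recovers the parameter \<open>s = h / r(h)\<close> from \<open>h\<close>.\<close>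

definition ratio :: "real \<Rightarrow> real" where "ratio = inv height"

lemma height_ratio [simp]: "height (ratio h) = h" and ratio_height [simp]: "ratio (height s) = s"
  using height_bij by (simp_all add: ratio_def bij_is_surj bij_is_inj surj_f_inv_f)

lemma ratio_less_iff: "ratio x < y \<longleftrightarrow> x < height y" and less_ratio_iff: "y < ratio x \<longleftrightarrow> height y < x"
  using height_mono height_ratio by (metis strict_mono_less)+

lemma ratio_deriv: "(ratio has_real_derivative (1 - ratio h * P (ratio h)) / radius (ratio h)) (at h)"
proof -
  have "isCont ratio (height (ratio h))"
    by (rule isCont_inverse_function[where d = 1]) (auto intro: DERIV_isCont[OF height_deriv])
  then have "(ratio has_real_derivative inverse (radius (ratio h) / (1 - ratio h * P (ratio h)))) (at h)"
    using radius_pos[of "ratio h"] den_pos[of "ratio h"]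
    by (intro DERIV_inverse_function[where f = height and a = "h - 1" and b = "h + 1"] height_deriv) auto
  then show ?thesis by simp
qed

lemma ratio_odd: "ratio (- h) = - ratio h"
  by (metis height_odd height_ratio ratio_height)

lemma ratio_at_top: "filterlim ratio at_top at_top"
  unfolding filterlim_at_top
proof
  fix Z
  show "eventually (\<lambda>h. Z \<le> ratio h) at_top"
    using eventually_ge_at_top[of "height Z"] by eventually_elim (metis not_le ratio_less_iff)
qed

section \<open>The profile as a function of height\<close>

definition curve :: "real \<Rightarrow> real" where "curve h = radius (ratio h)"

text \<open>The derivatives of \<open>radius\<close> and \<open>ratio\<close> cancel except for
  \<open>P\<close>, which confirms that \<open>P\<close> is the slope in terms of
  \<open>h\<close>.\<close>

lemma curve_deriv: "(curve has_real_derivative P (ratio h)) (at h)"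
proof -
  have "((radius \<circ> ratio) has_real_derivative
      radius (ratio h) * (P (ratio h) / (1 - ratio h * P (ratio h))) * ((1 - ratio h * P (ratio h)) / radius (ratio h))) (at h)"
    by (rule DERIV_chain[OF radius_deriv ratio_deriv])
  then show ?thesis
    using radius_pos[of "ratio h"] den_pos[of "ratio h"] by (simp add: o_def curve_def[abs_def])
qed

lemma deriv_curve: "deriv curve = (\<lambda>h. P (ratio h))"
  using curve_deriv by (auto intro: DERIV_imp_deriv)

lemma deriv_curve_deriv:
  "(deriv curve has_real_derivative slope_field k C (ratio h) (P (ratio h)) * ((1 - ratio h * P (ratio h)) / radius (ratio h))) (at h)"
  using DERIV_chain[OF P_deriv ratio_deriv] by (simp add: deriv_curve o_def)

lemma deriv2_curve:
  "deriv (deriv curve) h = slope_field k C (ratio h) (P (ratio h)) * ((1 - ratio h * P (ratio h)) / radius (ratio h))"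
  by (rule DERIV_imp_deriv[OF deriv_curve_deriv])

lemma curve_support: "curve h - h * deriv curve h = radius (ratio h) * (1 - ratio h * P (ratio h))"
proof -
  have "ratio h * radius (ratio h) = h" using height_ratio[of h] by (simp add: height_def)
  then show ?thesis
    by (simp only: deriv_curve curve_def right_diff_distrib mult_1_right flip: mult.assoc)
       (simp add: mult.commute)
qed

lemma curve_symmetric_expander:
  assumes "k = real n - 1"
  shows "symmetric_expander n C r0 curve"
proof -
  have "deriv (deriv curve) h / (1 + (deriv curve h)\<^sup>2)
      = (real n - 1) / curve h - (1 + (deriv curve h)\<^sup>2) / (C * (curve h - h * deriv curve h))" for h
  proof -
    define s p R w where "s = ratio h" and "p = P s" and "R = radius s" and "w = 1 - s * p"
    have pos: "0 < R" "0 < w" "0 < 1 + p\<^sup>2"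
      using radius_pos den_pos by (auto simp: R_def w_def p_def intro: add_pos_nonneg)
    have "deriv (deriv curve) h / (1 + p\<^sup>2) = (1 + p\<^sup>2) / w * (k - (1 + p\<^sup>2) / w / C) * (w / R) / (1 + p\<^sup>2)"
      by (simp add: deriv2_curve slope_field_def s_def p_def R_def w_def)
    also have "\<dots> = k / R - (1 + p\<^sup>2) / (C * (R * w))"
      using pos C by (simp add: divide_simps)
    finally show ?thesis
      using assms by (simp add: curve_support) (simp add: deriv_curve curve_def s_def p_def R_def w_def)
  qed
  moreover have "curve h - h * deriv curve h \<noteq> 0" for h
    using curve_support[of h] radius_pos[of "ratio h"] den_pos[of "ratio h"] by simp
  moreover have "curve differentiable (at h)" "deriv curve differentiable (at h)" for h
    using curve_deriv deriv_curve_deriv real_differentiable_def by blast+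
  ultimately have "expander_solution_on n C UNIV curve"
    unfolding expander_solution_on_def using radius_pos by (simp add: curve_def)
  moreover have "ratio 0 = 0" using ratio_height[of 0] by (simp add: height_def)
  ultimately show ?thesis
    unfolding symmetric_expander_def
    by (simp add: curve_def ratio_odd radius_def \<rho>_even \<rho>_0 deriv_curve P_0)
qed

lemma \<sigma>\<rho>_nonneg: "0 \<le> \<sigma> * \<rho> s"
proof -
  have "0 \<le> \<epsilon> * \<nu> / (2 * (\<epsilon> + \<mu>)) * ln (1 + \<bar>s\<bar>\<^sup>2)"
    using \<epsilon> \<nu> \<mu> by (intro mult_nonneg_nonneg ln_ge_zero) auto
  also have "\<dots> \<le> \<sigma> * \<rho> \<bar>s\<bar>" by (rule \<rho>_growth) simp
  also have "\<rho> \<bar>s\<bar> = \<rho> s" using \<rho>_even[of s] by (cases "s \<ge> 0") auto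
  finally show ?thesis .
qed

text \<open>The factor \<open>\<sigma>\<close> makes this a minimum at 0 for
  \<open>\<sigma> = 1\<close> and a maximum for \<open>\<sigma> = -1\<close>.\<close>

lemma curve_extremal: "\<sigma> * r0 \<le> \<sigma> * curve h"
  using \<sigma>\<rho>_nonneg[of "ratio h"] r0 \<sigma> by (auto simp: curve_def radius_def)

text \<open>The second derivative is the field times a positive factor, and since
  \<open>ratio\<close> is odd and increasing, the sign change at \<open>s = z\<close> becomes one at
  \<open>h = height z\<close>.\<close>

lemma curve_inflection: "\<exists>h1>0. \<forall>h. sgn (deriv (deriv curve) h) = \<sigma> * sgn (h1 - \<bar>h\<bar>)"
proof -
  obtain z where z: "z > 0" "\<And>s. sgn (slope_field k C s (P s)) = \<sigma> * sgn (z - \<bar>s\<bar>)"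
    using slope_sign_change by blast
  have "sgn (deriv (deriv curve) h) = \<sigma> * sgn (height z - \<bar>h\<bar>)" for h
  proof -
    have "\<bar>ratio h\<bar> = ratio \<bar>h\<bar>"
      using ratio_less_iff[of h 0] ratio_odd[of h] by (cases "h < 0") (auto simp: height_def)
    moreover have "sgn (z - ratio \<bar>h\<bar>) = sgn (height z - \<bar>h\<bar>)"
      using ratio_less_iff[of "\<bar>h\<bar>" z] less_ratio_iff[of z "\<bar>h\<bar>"] by (auto simp: sgn_if)
    moreover have "sgn (deriv (deriv curve) h) = sgn (slope_field k C (ratio h) (P (ratio h)))"
      unfolding deriv2_curve using radius_pos[of "ratio h"] den_pos[of "ratio h"] by (simp add: sgn_mult)
    ultimately show ?thesis using z(2)[of "ratio h"] by simp
  qed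
  moreover have "height z > 0" using z(1) radius_pos by (simp add: height_def)
  ultimately show ?thesis by blast
qed

lemma \<sigma>\<rho>_at_top: "filterlim (\<lambda>s. \<sigma> * \<rho> s) at_top at_top"
proof -
  have "0 < \<epsilon> * \<nu> / (2 * (\<epsilon> + \<mu>))" using \<epsilon> \<nu> \<mu> by simp
  moreover have "filterlim (\<lambda>s::real. ln (1 + s\<^sup>2)) at_top at_top"
    by (intro filterlim_compose[OF ln_at_top] filterlim_tendsto_add_at_top[OF tendsto_const]
        filterlim_pow_at_top filterlim_ident) auto
  ultimately have "filterlim (\<lambda>s. \<epsilon> * \<nu> / (2 * (\<epsilon> + \<mu>)) * ln (1 + s\<^sup>2)) at_top at_top"
    by (intro filterlim_tendsto_pos_mult_at_top[OF tendsto_const])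
  then show ?thesis
    by (rule filterlim_at_top_mono) (rule eventually_mono[OF eventually_ge_at_top[of 0] \<rho>_growth])
qed

lemma curve_limit_infinity: assumes "\<sigma> = 1" shows "filterlim curve at_top at_top"
proof -
  have "filterlim (\<lambda>s. r0 * exp (\<rho> s)) at_top at_top"
    using \<sigma>\<rho>_at_top assms r0
    by (intro filterlim_tendsto_pos_mult_at_top[OF tendsto_const] filterlim_compose[OF exp_at_top]) auto
  then show ?thesis
    unfolding curve_def[abs_def] radius_def by (rule filterlim_compose[OF _ ratio_at_top])
qed

lemma curve_limit_zero: assumes "\<sigma> = -1" shows "(curve \<longlongrightarrow> 0) at_top"
proof -
  have "filterlim \<rho> at_bot at_top"
    using \<sigma>\<rho>_at_top assms by (simp add: filterlim_uminus_at_bot)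
  then have "((\<lambda>s. r0 * exp (\<rho> s)) \<longlongrightarrow> r0 * 0) at_top"
    by (intro tendsto_mult tendsto_const filterlim_compose[OF exp_at_bot])
  then show ?thesis
    unfolding curve_def[abs_def] radius_def
    using filterlim_compose[OF _ ratio_at_top] by fastforce
qed

end

subsection \<open>The barriers\<close>

text \<open>Completing the square; equality holds at \<open>A = k * C / 2\<close>.\<close>

lemma quadratic_le: "A * (k - A / C) \<le> k\<^sup>2 * C / 4" if "0 < C" for A k C :: real
proof -
  have "0 \<le> (A - k * C / 2)\<^sup>2 / C" using that by simp
  then show ?thesis using that by (simp add: field_simps power2_eq_square)
qed

lemma lower_curve_slope_le:
  fixes \<nu> s :: real
  assumes "0 \<le> \<nu>"
  shows "\<nu> * (1 - s\<^sup>2) / (1 + s\<^sup>2)\<^sup>2 \<le> \<nu>"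
proof -
  have "1 \<le> (1 + s\<^sup>2)\<^sup>2" by (intro one_le_power) simp
  moreover have "1 - s\<^sup>2 \<le> 1" by simp
  ultimately have "(1 - s\<^sup>2) / (1 + s\<^sup>2)\<^sup>2 \<le> 1" by (simp only: pos_divide_le_eq)
  from mult_left_mono[OF this assms] show ?thesis by simp
qed

text \<open>Along the upper curve \<open>1 - s * x = 1 / v\<close> with \<open>v = 1 + \<epsilon> * s\<^sup>2\<close>, so the quotient
  \<open>(1 + x\<^sup>2) / (1 - s * x)\<close> is \<open>v + \<epsilon> * (1 - 1 / v)\<close>.\<close>
lemma slope_barriers_expanding:
  assumes k: "1 \<le> k" and C: "0 < C" and kC: "1 < k * C"
  shows "slope_barriers k C 1 ((k * C - 1) / (k * C + 3 + 2 * C)) (6 * C * k\<^sup>2) (6 * C * k\<^sup>2)"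
proof
  \<comment> \<open>With the factor 6, \<open>\<epsilon> / 3 = 2 * C * k\<^sup>2\<close>, so
    \<open>A \<ge> \<epsilon> / 3\<close> forces
    \<open>k - A / C \<le> k - 2 * k\<^sup>2 \<le> -1\<close>.\<close>
  define \<epsilon> where "\<epsilon> = 6 * C * k\<^sup>2"
  define K where "K = k * C"
  \<comment> \<open>The denominator adds up two requirements:
    \<open>\<nu> * (K + 3) \<le> K - 1\<close> gives \<open>A \<le> (K + 1) / 2\<close>, and
    \<open>\<nu> * (2 * C) \<le> K - 1\<close> gives
    \<open>\<nu> \<le> k - (K + 1) / 2 / C\<close>.\<close>
  define \<nu> where "\<nu> = (K - 1) / (K + 3 + 2 * C)"
  have K: "1 < K" using kC by (simp add: K_def)
  have \<nu>: "0 < \<nu>" "\<nu> < 1" using K C by (auto simp: \<nu>_def field_simps)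
  have K_le: "K \<le> K * k" using k K by simp
  have \<epsilon>_K: "\<epsilon> = 6 * (K * k)" by (simp add: \<epsilon>_def K_def power2_eq_square)
  have \<epsilon>6: "6 < \<epsilon>" using K K_le \<epsilon>_K by linarith
  show "0 < 6 * C * k\<^sup>2" using \<epsilon>6 by (simp add: \<epsilon>_def)
  show "0 < (k * C - 1) / (k * C + 3 + 2 * C)" using \<nu> by (simp add: \<nu>_def K_def)
  have "\<nu> * \<epsilon> \<le> 1 * \<epsilon>" using \<nu> \<epsilon>6 by (intro mult_right_mono) auto
  then show "(k * C - 1) / (k * C + 3 + 2 * C) \<le> 6 * C * k\<^sup>2"
    "(k * C - 1) / (k * C + 3 + 2 * C) * (6 * C * k\<^sup>2) \<le> 6 * C * k\<^sup>2"
    unfolding \<epsilon>_def[symmetric] K_def[symmetric] \<nu>_def[symmetric] using \<epsilon>6 \<nu> by auto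
  fix s :: real assume s: "0 \<le> s"
  have "\<nu> * (1 - s\<^sup>2) / (1 + s\<^sup>2)\<^sup>2 \<le> slope_field k C s (\<nu> * s / (1 + s\<^sup>2))"
  proof -
    define x where "x = \<nu> * s / (1 + s\<^sup>2)"
    define A where "A = (1 + x\<^sup>2) / (1 - s * x)"
    have p: "0 < 1 + s\<^sup>2" by (auto intro: add_pos_nonneg)
    have "2 * s \<le> 1 + s\<^sup>2" using zero_le_power2[of "s - 1"] by (simp add: power2_diff)
    then have "s / (1 + s\<^sup>2) \<le> 1" using p s by simp
    then have "\<nu> * (s / (1 + s\<^sup>2)) \<le> \<nu> * 1" using \<nu> by (intro mult_left_mono) auto
    then have x: "0 \<le> x" "x \<le> \<nu>" using s \<nu> p by (auto simp: x_def)
    have "s\<^sup>2 / (1 + s\<^sup>2) \<le> 1" using p by simp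
    then have "\<nu> * (s\<^sup>2 / (1 + s\<^sup>2)) \<le> \<nu> * 1" using \<nu> by (intro mult_left_mono) auto
    moreover have "s * x = \<nu> * (s\<^sup>2 / (1 + s\<^sup>2))" by (simp add: x_def power2_eq_square)
    moreover have "0 \<le> s * x" using x s by simp
    ultimately have sx: "0 \<le> s * x" "s * x \<le> \<nu>" by linarith+
    have x2: "x\<^sup>2 \<le> \<nu>"
    proof -
      have "x * x \<le> \<nu> * 1" using x \<nu> by (intro mult_mono) auto
      then show ?thesis by (simp add: power2_eq_square)
    qed
    have "\<nu> * (K + 3 + 2 * C) = K - 1" using K C by (simp add: \<nu>_def)
    moreover have "0 \<le> \<nu> * (K + 3)" "0 \<le> \<nu> * (2 * C)" using K C \<nu> by auto
    ultimately have \<nu>_bound: "\<nu> * (K + 3) \<le> K - 1" "\<nu> * (2 * C) \<le> K - 1"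
      unfolding distrib_left[of \<nu> "K + 3"] by linarith+
    have "A \<le> (1 + \<nu>) / (1 - \<nu>)" unfolding A_def using x2 sx \<nu> by (intro frac_le) auto
    also have "\<dots> \<le> (K + 1) / 2"
    proof -
      have "2 * (1 + \<nu>) \<le> (K + 1) * (1 - \<nu>)" using \<nu>_bound(1) by (simp add: algebra_simps)
      then show ?thesis using \<nu> by (simp add: pos_divide_le_eq)
    qed
    finally have A2: "A \<le> (K + 1) / 2" .
    have A1: "1 \<le> A" unfolding A_def using sx \<nu> by (simp add: field_simps add_increasing)
    have "\<nu> \<le> (K - 1) / (2 * C)" using \<nu>_bound(2) C by (simp add: field_simps)
    also have "\<dots> = k - (K + 1) / 2 / C" using C by (simp add: K_def field_simps)
    also have "\<dots> \<le> k - A / C" using divide_right_mono[OF A2, of C] C by linarith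
    finally have "\<nu> \<le> k - A / C" .
    moreover from this have "k - A / C \<le> A * (k - A / C)" using A1 \<nu> by simp
    moreover have "\<nu> * (1 - s\<^sup>2) / (1 + s\<^sup>2)\<^sup>2 \<le> \<nu>"
      by (rule lower_curve_slope_le) (use \<nu> in simp)
    ultimately show ?thesis by (simp add: slope_field_def x_def[symmetric] A_def[symmetric])
  qed
  then show "(k * C - 1) / (k * C + 3 + 2 * C) * (1 - s\<^sup>2) / (1 + s\<^sup>2)\<^sup>2
      \<le> 1 * slope_field k C s (1 * ((k * C - 1) / (k * C + 3 + 2 * C) * s / (1 + s\<^sup>2)))"
    by (simp add: \<nu>_def K_def)
  have "slope_field k C s (\<epsilon> * s / (1 + \<epsilon> * s\<^sup>2)) \<le> \<epsilon> * (1 - \<epsilon> * s\<^sup>2) / (1 + \<epsilon> * s\<^sup>2)\<^sup>2"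
  proof -
    define v where "v = 1 + \<epsilon> * s\<^sup>2"
    define x where "x = \<epsilon> * s / v"
    define A where "A = (1 + x\<^sup>2) / (1 - s * x)"
    have v: "1 \<le> v" using \<epsilon>6 by (simp add: v_def)
    have den: "1 - s * x = 1 / v" using v by (simp add: x_def v_def field_simps power2_eq_square)
    have "x\<^sup>2 = \<epsilon> * (v - 1) / v\<^sup>2" by (simp add: x_def v_def power2_eq_square field_simps)
    then have A_eq: "A = v + \<epsilon> * (v - 1) / v"
      unfolding A_def den using v by (simp add: field_simps power2_eq_square)
    have "A * (k - A / C) \<le> \<epsilon> * (2 - v) / v\<^sup>2"
    \<comment> \<open>For small \<open>v\<close> the maximum \<open>\<epsilon> / 24\<close> of the
      quadratic in \<open>A\<close> already lies below the slope of the barrier. For larger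
      \<open>v\<close>, \<open>A\<close> is so big that the field is at most
      \<open>- (\<epsilon> / 3)\<close>, which lies below that slope for every
      \<open>v\<close>.\<close>
    proof (cases "v \<le> 3 / 2")
      case True
      have "k\<^sup>2 * C / 4 = \<epsilon> / 24" by (simp add: \<epsilon>_def)
      moreover have "\<epsilon> / 24 \<le> \<epsilon> * (1 / 2) / (9 / 4)" using \<epsilon>6 by simp
      moreover have "\<epsilon> * (1 / 2) / (9 / 4) \<le> \<epsilon> * (2 - v) / v\<^sup>2"
      proof (rule frac_le)
        show "v\<^sup>2 \<le> 9 / 4" using power_mono[OF True, of 2] v by (simp add: power2_eq_square)
        show "\<epsilon> * (1 / 2) \<le> \<epsilon> * (2 - v)" using True \<epsilon>6 by (intro mult_left_mono) auto
      qed (use v True \<epsilon>6 in auto)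
      ultimately show ?thesis using quadratic_le[OF C, of A k] by linarith
    next
      case False
      then have "1 / 3 \<le> (v - 1) / v" by (simp add: field_simps)
      then have "\<epsilon> * (1 / 3) \<le> \<epsilon> * ((v - 1) / v)" using \<epsilon>6 by (intro mult_left_mono) auto
      then have A3: "\<epsilon> / 3 \<le> A" using v by (simp add: A_eq)
      have "2 * k\<^sup>2 = \<epsilon> / 3 / C" using C by (simp add: \<epsilon>_def)
      also have "\<dots> \<le> A / C" using A3 C by (intro divide_right_mono) auto
      finally have "2 * k\<^sup>2 \<le> A / C" .
      moreover have "k \<le> k\<^sup>2" "1 \<le> k\<^sup>2" using k self_le_power[of k 2] by auto
      ultimately have "k - A / C \<le> -1" by linarith
      then have "A * (k - A / C) \<le> A * (-1)" using A3 \<epsilon>6 by (intro mult_left_mono) auto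
      also have "\<dots> \<le> - (\<epsilon> / 3)" using A3 by simp
      also have "\<dots> \<le> \<epsilon> * (2 - v) / v\<^sup>2"
      proof -
        have "v * 3 \<le> 6 + v\<^sup>2" using zero_le_power2[of "v - 3 / 2"] by (simp add: power2_eq_square algebra_simps)
        then have "- (1 / 3) \<le> (2 - v) / v\<^sup>2" using v by (simp add: field_simps)
        then have "\<epsilon> * (- (1 / 3)) \<le> \<epsilon> * ((2 - v) / v\<^sup>2)" using \<epsilon>6 by (intro mult_left_mono) auto
        then show ?thesis by simp
      qed
      finally show ?thesis .
    qed
    moreover have "2 - v = 1 - \<epsilon> * s\<^sup>2" by (simp add: v_def)
    ultimately show ?thesis by (simp add: slope_field_def v_def[symmetric] x_def[symmetric] A_def[symmetric])
  qed
  then show "1 * slope_field k C s (1 * (6 * C * k\<^sup>2 * s / (1 + 6 * C * k\<^sup>2 * s\<^sup>2)))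
      \<le> 6 * C * k\<^sup>2 * (1 - 6 * C * k\<^sup>2 * s\<^sup>2) / (1 + 6 * C * k\<^sup>2 * s\<^sup>2)\<^sup>2"
    by (simp add: \<epsilon>_def)
qed (use assms in auto)

text \<open>Along the upper curve \<open>(1 + x\<^sup>2) / (1 - s * x) = (1 + e) / v\<close> with \<open>v = 1 + \<epsilon> * s\<^sup>2\<close> and
  \<open>0 \<le> e \<le> \<epsilon> * v\<close>.  For \<open>\<epsilon> = 0\<close> the curve is \<open>r' = - h / r\<close>, the spheres about the origin, and the
  barrier inequality reduces to \<open>1 / C \<le> k + 1\<close>.\<close>
lemma slope_barriers_contracting:
  assumes k: "1 \<le> k" and C: "0 < C" and kC: "k * C < 1" and nC: "1 < (k + 1) * C"
  shows "slope_barriers k C (-1) ((1 - k * C) / 4) 1 ((k + 1 - 1 / C) * C\<^sup>2 / 8)"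
proof
  \<comment> \<open>The slack in \<open>1 / C < k + 1\<close>; \<open>\<epsilon>\<close> is then
    chosen so that \<open>\<epsilon> * (4 / C) * (2 / C) = \<delta>\<close>.\<close>
  define \<delta> where "\<delta> = k + 1 - 1 / C"
  define \<epsilon> where "\<epsilon> = \<delta> * C\<^sup>2 / 8"
  \<comment> \<open>Makes \<open>(1 - \<nu>) / C - k\<close> equal to \<open>3 * \<nu> / C\<close>,
    which is more than enough after multiplication by \<open>A \<ge> 1 / 2\<close>.\<close>
  define \<nu> where "\<nu> = (1 - k * C) / 4"
  have "1 * C \<le> k * C" using k C by (intro mult_right_mono) auto
  then have C1: "C < 1" using kC by simp
  have \<delta>: "0 < \<delta>" "\<delta> < 1" using kC nC C by (auto simp: \<delta>_def field_simps)
  have "\<delta> * C * C \<le> 1 * 1 * C" using \<delta> C C1 by (intro mult_mono) auto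
  then have \<epsilon>: "0 < \<epsilon>" "\<epsilon> \<le> C / 8" using \<delta> C by (auto simp: \<epsilon>_def power2_eq_square mult_ac)
  have "0 < k * C" using k C by simp
  then have \<nu>: "0 < \<nu>" "\<nu> < 1 / 4" using kC by (auto simp: \<nu>_def)
  show "0 < (k + 1 - 1 / C) * C\<^sup>2 / 8" "0 < (1 - k * C) / 4" "(1 - k * C) / 4 \<le> 1" "- 1 * 1 \<le> (k + 1 - 1 / C) * C\<^sup>2 / 8"
    using \<epsilon> \<nu> unfolding \<delta>_def[symmetric] \<epsilon>_def[symmetric] \<nu>_def[symmetric] by auto
  have "\<nu> * \<epsilon> \<le> 1 * 1" using \<nu> \<epsilon> C1 by (intro mult_mono) auto
  then show "(1 - k * C) / 4 * ((k + 1 - 1 / C) * C\<^sup>2 / 8) \<le> 1"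
    by (simp add: \<delta>_def \<epsilon>_def \<nu>_def)
  fix s :: real assume s: "0 \<le> s"
  have "\<nu> * (1 - s\<^sup>2) / (1 + s\<^sup>2)\<^sup>2 \<le> - slope_field k C s (- (\<nu> * s / (1 + s\<^sup>2)))"
  proof -
    define x where "x = \<nu> * s / (1 + s\<^sup>2)"
    define A where "A = (1 + x\<^sup>2) / (1 + s * x)"
    have p: "0 < 1 + s\<^sup>2" by (auto intro: add_pos_nonneg)
    have x: "0 \<le> x" using s \<nu> p by (auto simp: x_def)
    have "s\<^sup>2 / (1 + s\<^sup>2) \<le> 1" using p by simp
    then have "\<nu> * (s\<^sup>2 / (1 + s\<^sup>2)) \<le> \<nu> * 1" using \<nu> by (intro mult_left_mono) auto
    moreover have "s * x = \<nu> * (s\<^sup>2 / (1 + s\<^sup>2))" by (simp add: x_def power2_eq_square)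
    moreover have "0 \<le> s * x" using x s by simp
    ultimately have sx: "0 \<le> s * x" "s * x \<le> \<nu>" by linarith+
    have "1 - \<nu> \<le> 1 / (1 + \<nu>)" using \<nu> by (simp add: field_simps)
    also have "\<dots> \<le> A" unfolding A_def using sx \<nu> by (intro frac_le) auto
    finally have A: "1 - \<nu> \<le> A" .
    have "3 * \<nu> / C = (1 - \<nu>) / C - k" using C by (simp add: \<nu>_def field_simps)
    also have "\<dots> \<le> A / C - k" using A C by (simp add: divide_right_mono)
    finally have "3 * \<nu> / C \<le> A / C - k" .
    moreover have "3 * \<nu> \<le> 3 * \<nu> / C" using \<nu> C C1 by (simp add: field_simps)
    ultimately have B: "3 * \<nu> \<le> A / C - k" by linarith
    have "(1 / 2) * (3 * \<nu>) \<le> A * (A / C - k)"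
      using A B \<nu> by (intro mult_mono) auto
    then have "\<nu> \<le> A * (A / C - k)" using \<nu> by linarith
    moreover have "\<nu> * (1 - s\<^sup>2) / (1 + s\<^sup>2)\<^sup>2 \<le> \<nu>"
      by (rule lower_curve_slope_le) (use \<nu> in simp)
    moreover have "- slope_field k C s (- x) = A * (A / C - k)"
      by (simp add: slope_field_def A_def[symmetric] algebra_simps)
    ultimately show ?thesis by (simp add: x_def)
  qed
  then show "(1 - k * C) / 4 * (1 - s\<^sup>2) / (1 + s\<^sup>2)\<^sup>2
      \<le> - 1 * slope_field k C s (- 1 * ((1 - k * C) / 4 * s / (1 + s\<^sup>2)))"
    by (simp add: \<nu>_def)
  have "- slope_field k C s (- (s / (1 + \<epsilon> * s\<^sup>2))) \<le> (1 - \<epsilon> * s\<^sup>2) / (1 + \<epsilon> * s\<^sup>2)\<^sup>2"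
  proof -
    define v where "v = 1 + \<epsilon> * s\<^sup>2"
    define x where "x = s / v"
    define A where "A = (1 + x\<^sup>2) / (1 + s * x)"
    define e where "e = v * (v - 1) / (v + s\<^sup>2)"
    have v: "1 \<le> v" using \<epsilon> by (simp add: v_def)
    have vs: "0 < v + s\<^sup>2" using v by (auto intro: add_pos_nonneg)
    have "A = (v\<^sup>2 + s\<^sup>2) / v\<^sup>2 / ((v + s\<^sup>2) / v)"
      unfolding A_def x_def using v by (simp add: field_simps power2_eq_square)
    also have "\<dots> = (v\<^sup>2 + s\<^sup>2) / (v + s\<^sup>2) / v"
      using v by (simp add: power2_eq_square)
    also have "(v\<^sup>2 + s\<^sup>2) / (v + s\<^sup>2) = 1 + e"
      unfolding e_def using vs by (simp add: field_simps power2_eq_square)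
    finally have A_eq: "A = (1 + e) / v" .
    have e0: "0 \<le> e" unfolding e_def using v vs by simp
    have e1: "e \<le> \<epsilon> * v"
    proof -
      have "v * (\<epsilon> * s\<^sup>2) \<le> v * (\<epsilon> * (v + s\<^sup>2))" using v \<epsilon> by (intro mult_left_mono) auto
      then show ?thesis unfolding e_def using vs by (simp add: pos_divide_le_eq v_def mult_ac)
    qed
    have small: "e * (2 / C + e / C - v) \<le> \<delta>"
    \<comment> \<open>For small \<open>v\<close>, \<open>e / C \<le> v\<close> leaves only
      \<open>e * (2 / C)\<close>, and \<open>e\<close> is at most
      \<open>\<epsilon> * (4 / C)\<close>. For large \<open>v\<close> the bracket is
      nonpositive.\<close>
    proof (cases "v \<le> 4 / C")
      case True
      have "\<epsilon> * v \<le> \<epsilon> * (4 / C)" using True \<epsilon> by (intro mult_left_mono) auto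
      then have e_le: "e \<le> \<epsilon> * (4 / C)" using e1 by simp
      have "\<epsilon> * v \<le> C * v" using \<epsilon> v C by (intro mult_right_mono) auto
      then have "e / C \<le> v" using e1 C by (simp add: field_simps)
      then have "e * (2 / C + e / C - v) \<le> e * (2 / C)" using e0 by (intro mult_left_mono) auto
      also have "\<dots> \<le> \<epsilon> * (4 / C) * (2 / C)" using e_le C by (intro mult_right_mono) auto
      also have "\<dots> = \<delta>" using C by (simp add: \<epsilon>_def power2_eq_square)
      finally show ?thesis .
    next
      case False
      have "\<epsilon> * v \<le> C / 8 * v" using \<epsilon> v by (intro mult_right_mono) auto
      then have "e / C \<le> v / 8" using e1 C by (simp add: field_simps)
      moreover have "2 / C \<le> v / 2" using False by simp
      ultimately have "2 / C + e / C - v \<le> 0" using v by linarith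
      then have "e * (2 / C + e / C - v) \<le> 0" using e0 by (rule mult_nonneg_nonpos[rotated])
      then show ?thesis using \<delta> by linarith
    qed
    \<comment> \<open>As \<open>v * (1 + e) \<ge> 1\<close>, all but one copy of this product may be
      replaced by 1; subtracting the result from \<open>k + 1 + v * e\<close> leaves exactly
      \<open>2 - v\<close>.\<close>
    have "(k - 1) * 1 \<le> (k - 1) * (v * (1 + e))"
      using k v e0 by (intro mult_left_mono) (auto simp: mult_ge1_I)
    then have kv: "k - 1 + v * (1 + e) \<le> k * (v * (1 + e))" by (simp add: algebra_simps)
    have "(1 + e)\<^sup>2 / C = 1 / C + e * (2 / C + e / C)"
      by (simp add: power2_eq_square algebra_simps add_divide_distrib)
    also have "\<dots> \<le> k + 1 + v * e"
      using small by (simp add: \<delta>_def algebra_simps)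
    finally have main: "(1 + e)\<^sup>2 / C - k * (v * (1 + e)) \<le> 2 - v" using kv by (simp add: algebra_simps)
    have "A * (A / C - k) = ((1 + e)\<^sup>2 / C - k * (v * (1 + e))) / v\<^sup>2"
      unfolding A_eq power2_eq_square using v C by (simp add: divide_simps) (simp add: algebra_simps)
    also have "\<dots> \<le> (2 - v) / v\<^sup>2" by (rule divide_right_mono[OF main]) simp
    finally have "A * (A / C - k) \<le> (2 - v) / v\<^sup>2" .
    moreover have "- slope_field k C s (- x) = A * (A / C - k)"
      by (simp add: slope_field_def A_def[symmetric] algebra_simps)
    moreover have "2 - v = 1 - \<epsilon> * s\<^sup>2" by (simp add: v_def)
    ultimately show ?thesis by (simp add: v_def[symmetric] x_def[symmetric])
  qed
  then show "- 1 * slope_field k C s (- 1 * (1 * s / (1 + (k + 1 - 1 / C) * C\<^sup>2 / 8 * s\<^sup>2)))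
      \<le> 1 * (1 - (k + 1 - 1 / C) * C\<^sup>2 / 8 * s\<^sup>2) / (1 + (k + 1 - 1 / C) * C\<^sup>2 / 8 * s\<^sup>2)\<^sup>2"
    by (simp add: \<epsilon>_def \<delta>_def)
qed (use assms in auto)

subsection \<open>Existence and uniqueness\<close>

text \<open>\<open>P\<close> comes from \<open>slope_solution\<close>. Since
  \<open>1 - s * P s\<close> has no zero, the odd function \<open>P s / (1 - s * P s)\<close> is
  continuous, and \<open>\<rho>\<close> is its even antiderivative vanishing at 0.\<close>

lemma (in slope_barriers) symmetric_expander_exists:
  assumes "0 < r0" "k = real n - 1"
  shows "\<exists>r. symmetric_expander n C r0 r \<and> (\<forall>h. \<sigma> * r0 \<le> \<sigma> * r h)
    \<and> (\<exists>h1>0. \<forall>h. sgn (deriv (deriv r) h) = \<sigma> * sgn (h1 - \<bar>h\<bar>))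
    \<and> (\<sigma> = 1 \<longrightarrow> filterlim r at_top at_top) \<and> (\<sigma> = -1 \<longrightarrow> (r \<longlongrightarrow> 0) at_top)"
proof -
  obtain P where P: "\<And>s. (P has_real_derivative slope_field k C s (P s)) (at s)"
    and odd: "\<And>s. P (- s) = - P s"
    and b: "\<And>s. 0 \<le> s \<Longrightarrow> lo s \<le> \<sigma> * P s" "\<And>s. 0 \<le> s \<Longrightarrow> \<sigma> * P s \<le> hi s"
    using slope_solution by blast
  have den: "1 - s * P s \<noteq> 0" for s
  proof -
    have *: "0 < 1 - s * P s" if "0 \<le> s" for s
    proof -
      have "0 < 1 / (1 + \<epsilon> * s\<^sup>2)" using pos_den[of s] by simp
      also have "\<dots> \<le> 1 - s * (\<sigma> * (\<sigma> * P s))"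
        using b[OF that] lo_nonneg[OF that] that by (intro den_bounds) auto
      finally show ?thesis using \<sigma> by auto
    qed
    show ?thesis using *[of s] *[of "- s"] odd[of s] by (cases "0 \<le> s") auto
  qed
  have contP: "isCont P s" for s by (rule DERIV_isCont[OF P])
  have "isCont (\<lambda>s. P s / (1 - s * P s)) s" for s
    by (intro continuous_intros contP den)
  then obtain F where "\<And>s. (F has_vector_derivative P s / (1 - s * P s)) (at s)"
    using einterval_antiderivative[of "-\<infinity>" "\<infinity>" "\<lambda>s. P s / (1 - s * P s)"] by auto
  then have F: "(F has_real_derivative P s / (1 - s * P s)) (at s)" for s
    by (simp add: has_real_derivative_iff_has_vector_derivative)
  define \<rho> where "\<rho> s = F s - F 0" for s
  have \<rho>: "(\<rho> has_real_derivative P s / (1 - s * P s)) (at s)" for s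
    using DERIV_diff[OF F[of s] DERIV_const[of "F 0"]] by (simp add: \<rho>_def[abs_def])
  have even: "\<rho> (- s) = \<rho> s" for s
  proof -
    have "((\<lambda>s. \<rho> s - \<rho> (- s)) has_real_derivative 0) (at s)" for s
    proof -
      have "((\<lambda>s. \<rho> (- s)) has_real_derivative P (- s) / (1 - (- s) * P (- s)) * (- 1)) (at s)"
        by (rule DERIV_chain2[OF \<rho>]) (auto intro!: derivative_eq_intros)
      from DERIV_diff[OF \<rho> this] show ?thesis by (simp add: odd)
    qed
    then have "\<rho> s - \<rho> (- s) = \<rho> 0 - \<rho> (- 0)" by (intro DERIV_isconst_all) auto
    then show ?thesis by simp
  qed
  interpret profile k C \<sigma> \<nu> \<mu> \<epsilon> P \<rho> r0
    by unfold_locales (use assms(1) P odd b \<rho> even in \<open>auto simp: \<rho>_def\<close>)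
  show ?thesis
    using curve_symmetric_expander[OF assms(2)] curve_extremal curve_inflection
      curve_limit_infinity curve_limit_zero by blast
qed

lemma symmetric_expander_const:
  assumes "0 < r0" "C = 1 / (real n - 1)" "n \<ge> 2"
  shows "symmetric_expander n C r0 (\<lambda>_. r0)"
proof -
  have [simp]: "deriv (\<lambda>_. r0) = (\<lambda>_. 0)" "deriv (\<lambda>_. 0 :: real) = (\<lambda>_. 0)" by auto
  show ?thesis
    unfolding symmetric_expander_def expander_solution_on_def
    using assms by simp
qed

section \<open>Uniqueness\<close>

lemma quotient_diff_eq:
  fixes a b :: real
  assumes "x \<noteq> 0" "y \<noteq> 0"
  shows "a / x - b / y = (a - b) / x - b / (x * y) * (x - y)"
  using assms by (simp add: field_simps)

text \<open>Along two given solutions the difference of the right-hand sides is linear in the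
  differences of values and slopes, with coefficients \<open>\<alpha>\<close> and
  \<open>\<beta>\<close> that are continuous because no denominator vanishes. They are bounded on
  each \<open>{0..H}\<close>, so Gronwall applies to the squared distance in the phase plane;
  symmetry gives negative \<open>h\<close>.\<close>

lemma symmetric_expander_unique:
  assumes "C > 0" and r: "symmetric_expander n C r0 r" and t: "symmetric_expander n C r0 t" and "r0 > 0"
  shows "r = t"
proof -
  define \<Phi> where "\<Phi> h x p = (1 + p\<^sup>2) * ((real n - 1) / x - (1 + p\<^sup>2) / (C * (x - h * p)))" for h x p :: real
  have facts: "(u has_real_derivative deriv u h) (at h)" "(deriv u has_real_derivative \<Phi> h (u h) (deriv u h)) (at h)"
     "u h > 0" "u h - h * deriv u h \<noteq> 0" "u (- h) = u h" "u 0 = r0" "deriv u 0 = 0"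
    if "symmetric_expander n C r0 u" for u h
  proof -
    note u = that[unfolded symmetric_expander_def expander_solution_on_def]
    have nz: "1 + (deriv u h)\<^sup>2 \<noteq> 0" by (metis add_pos_nonneg less_irrefl zero_le_power2 zero_less_one)
    have "deriv (deriv u) h = \<Phi> h (u h) (deriv u h)"
    proof -
      have "deriv (deriv u) h = (1 + (deriv u h)\<^sup>2) * (deriv (deriv u) h / (1 + (deriv u h)\<^sup>2))"
        using nz by simp
      also have "\<dots> = \<Phi> h (u h) (deriv u h)" unfolding \<Phi>_def using u by (intro arg_cong2[of _ _ _ _ "(*)"]) auto
      finally show ?thesis .
    qed
    then show "(deriv u has_real_derivative \<Phi> h (u h) (deriv u h)) (at h)"
      using u by (metis DERIV_deriv_iff_real_differentiable UNIV_I)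
    show "(u has_real_derivative deriv u h) (at h)"
      using u by (metis DERIV_deriv_iff_real_differentiable UNIV_I)
    show "u h > 0" "u h - h * deriv u h \<noteq> 0" "u (- h) = u h" "u 0 = r0" "deriv u 0 = 0" using u by auto
  qed
  note rf = facts[OF r] and tf = facts[OF t]
  define p q where "p = deriv r" and "q = deriv t"
  note rf = rf[folded p_def] and tf = tf[folded q_def]
  define w z where "w h = r h - h * p h" and "z h = t h - h * q h" for h
  have nz: "r h \<noteq> 0" "t h \<noteq> 0" "w h \<noteq> 0" "z h \<noteq> 0" for h
    using rf(3,4)[of h] tf(3,4)[of h] by (auto simp: w_def z_def)
  have cont: "continuous_on T r" "continuous_on T t" "continuous_on T p" "continuous_on T q" for T
    using rf(1,2) tf(1,2) by (meson DERIV_isCont continuous_at_imp_continuous_on)+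
  have contw: "continuous_on T w" "continuous_on T z" for T
    unfolding w_def z_def by (intro continuous_intros cont)+
  define \<alpha> where "\<alpha> h = 1 / C * ((1 + (q h)\<^sup>2)\<^sup>2 / (w h * z h))
    - (real n - 1) * ((1 + (q h)\<^sup>2) / (r h * t h))" for h
  define \<beta> where "\<beta> h = (real n - 1) * ((p h + q h) / r h)
    - 1 / C * ((2 + (p h)\<^sup>2 + (q h)\<^sup>2) * (p h + q h) / w h + (1 + (q h)\<^sup>2)\<^sup>2 / (w h * z h) * h)" for h
  have regroup: "m * (u * e - a * x) - c * (v * e - b * (x - h * e)) = (c * b - m * a) * x + (m * u - c * (v + b * h)) * e"
    for m u e a x c v b h :: real
    by (simp add: algebra_simps)
  have \<Phi>_diff: "\<Phi> h (r h) (p h) - \<Phi> h (t h) (q h) = \<alpha> h * (r h - t h) + \<beta> h * (p h - q h)" for h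
  proof -
    have "\<Phi> h (r h) (p h) - \<Phi> h (t h) (q h)
      = (real n - 1) * ((1 + (p h)\<^sup>2) / r h - (1 + (q h)\<^sup>2) / t h)
        - 1 / C * ((1 + (p h)\<^sup>2)\<^sup>2 / w h - (1 + (q h)\<^sup>2)\<^sup>2 / z h)"
      unfolding \<Phi>_def w_def[symmetric] z_def[symmetric] power2_eq_square
      by (simp only: right_diff_distrib left_diff_distrib times_divide_eq_right times_divide_eq_left
          divide_divide_eq_left mult_1 mult_ac)
    also have "\<dots> = (real n - 1) * (((p h)\<^sup>2 - (q h)\<^sup>2) / r h - (1 + (q h)\<^sup>2) / (r h * t h) * (r h - t h))
        - 1 / C * (((1 + (p h)\<^sup>2)\<^sup>2 - (1 + (q h)\<^sup>2)\<^sup>2) / w h - (1 + (q h)\<^sup>2)\<^sup>2 / (w h * z h) * (w h - z h))"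
      using quotient_diff_eq[OF nz(1,2), of "1 + (p h)\<^sup>2" h "1 + (q h)\<^sup>2" h]
        quotient_diff_eq[OF nz(3,4), of "(1 + (p h)\<^sup>2)\<^sup>2" h "(1 + (q h)\<^sup>2)\<^sup>2" h] by simp
    also have "((1 + (p h)\<^sup>2)\<^sup>2 - (1 + (q h)\<^sup>2)\<^sup>2) / w h
        = (2 + (p h)\<^sup>2 + (q h)\<^sup>2) * (p h + q h) / w h * (p h - q h)"
      by (simp add: power2_eq_square algebra_simps)
    also have "((p h)\<^sup>2 - (q h)\<^sup>2) / r h = (p h + q h) / r h * (p h - q h)"
      by (simp add: power2_eq_square algebra_simps)
    also have "w h - z h = (r h - t h) - h * (p h - q h)" by (simp add: w_def z_def algebra_simps)
    finally show ?thesis unfolding regroup \<alpha>_def \<beta>_def .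
  qed
  have "r H = t H" if "0 \<le> H" for H
  proof -
    have "continuous_on {0..H} \<alpha>" "continuous_on {0..H} \<beta>"
      unfolding \<alpha>_def \<beta>_def using nz \<open>C > 0\<close> by (auto intro!: continuous_intros cont contw)
    then have "bounded (\<alpha> ` {0..H})" "bounded (\<beta> ` {0..H})"
      by (auto intro!: compact_imp_bounded compact_continuous_image)
    then obtain a b where "\<forall>y\<in>\<alpha> ` {0..H}. norm y \<le> a" "\<forall>y\<in>\<beta> ` {0..H}. norm y \<le> b"
      unfolding bounded_iff by blast
    then have ab: "\<bar>\<alpha> h\<bar> \<le> a" "\<bar>\<beta> h\<bar> \<le> b" if "h \<in> {0..H}" for h using that by auto
    have "(r H - t H)\<^sup>2 + (p H - q H)\<^sup>2 \<le> 0"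
    proof (rule gronwall_nonpos[where d = "\<lambda>h. (r h - t h)\<^sup>2 + (p h - q h)\<^sup>2" and S = H and K = "1 + a + 2 * b"
          and d' = "\<lambda>h. 2 * (r h - t h) * (p h - q h) + 2 * (p h - q h) * (\<Phi> h (r h) (p h) - \<Phi> h (t h) (q h))"])
      fix h assume h: "h \<in> {0..H}"
      have "((\<lambda>h. (r h - t h)\<^sup>2 + (p h - q h)\<^sup>2) has_real_derivative
          2 * (r h - t h) * (p h - q h) + 2 * (p h - q h) * (\<Phi> h (r h) (p h) - \<Phi> h (t h) (q h))) (at h)"
        by (auto intro!: derivative_eq_intros rf(1,2) tf(1,2) simp: algebra_simps)
      then show "((\<lambda>h. (r h - t h)\<^sup>2 + (p h - q h)\<^sup>2) has_real_derivative
          2 * (r h - t h) * (p h - q h) + 2 * (p h - q h) * (\<Phi> h (r h) (p h) - \<Phi> h (t h) (q h))) (at h within {0..H})"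
        by (rule has_field_derivative_at_within)
      define x y where "x = r h - t h" and "y = p h - q h"
      \<comment> \<open>Absorbs the two mixed terms, which contribute \<open>1 + a\<close> to the
        Gronwall constant; the term with \<open>\<beta>\<close> contributes
        \<open>2 * b\<close>.\<close>
      have xy: "2 * \<bar>x * y\<bar> \<le> x\<^sup>2 + y\<^sup>2"
        using zero_le_power2[of "\<bar>x\<bar> - \<bar>y\<bar>"] by (simp add: power2_diff abs_mult)
      have "2 * (x * y) * \<alpha> h \<le> \<bar>2 * (x * y)\<bar> * \<bar>\<alpha> h\<bar>" by (metis abs_ge_self abs_mult)
      also have "\<dots> \<le> (x\<^sup>2 + y\<^sup>2) * a" using ab(1)[OF h] xy by (intro mult_mono) auto
      finally have 1: "2 * (x * y) * \<alpha> h \<le> (x\<^sup>2 + y\<^sup>2) * a" .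
      have b0: "0 \<le> b" using ab(2)[OF h] by linarith
      have "2 * y\<^sup>2 * \<beta> h \<le> 2 * y\<^sup>2 * b" using ab(2)[OF h] by (intro mult_left_mono) auto
      also have "\<dots> \<le> 2 * (x\<^sup>2 + y\<^sup>2) * b" using b0 by (intro mult_right_mono) auto
      finally have 2: "2 * y\<^sup>2 * \<beta> h \<le> 2 * (x\<^sup>2 + y\<^sup>2) * b" .
      have "2 * x * y + 2 * y * (\<alpha> h * x + \<beta> h * y) = 2 * (x * y) + 2 * (x * y) * \<alpha> h + 2 * y\<^sup>2 * \<beta> h"
        by (simp add: power2_eq_square algebra_simps)
      also have "\<dots> \<le> (x\<^sup>2 + y\<^sup>2) + (x\<^sup>2 + y\<^sup>2) * a + 2 * (x\<^sup>2 + y\<^sup>2) * b" using 1 2 xy by linarith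
      also have "\<dots> = (1 + a + 2 * b) * (x\<^sup>2 + y\<^sup>2)" by (simp add: algebra_simps)
      finally show "2 * (r h - t h) * (p h - q h) + 2 * (p h - q h) * (\<Phi> h (r h) (p h) - \<Phi> h (t h) (q h))
          \<le> (1 + a + 2 * b) * ((r h - t h)\<^sup>2 + (p h - q h)\<^sup>2)"
        by (simp add: \<Phi>_diff x_def y_def)
    next
      show "(r 0 - t 0)\<^sup>2 + (p 0 - q 0)\<^sup>2 \<le> 0" using rf(6,7) tf(6,7) by simp
    qed (use that in auto)
    then show ?thesis by (simp add: sum_power2_le_zero_iff)
  qed
  then have "r \<bar>h\<bar> = t \<bar>h\<bar>" for h by simp
  moreover have "r \<bar>h\<bar> = r h" "t \<bar>h\<bar> = t h" for h
    using rf(5)[of h] tf(5)[of h] by (auto simp: abs_if)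
  ultimately have "r h = t h" for h by metis
  then show ?thesis by blast
qed

theorem theorem21:
  fixes n :: nat and C r\<^sub>0 :: real
  assumes "n \<ge> 2" and "C > 1 / real n" and "r\<^sub>0 > 0"
  shows "(\<exists>!r. symmetric_expander n C r\<^sub>0 r) \<and>
    (\<forall>r. symmetric_expander n C r\<^sub>0 r \<longrightarrow>
      (C = 1 / (real n - 1) \<longrightarrow> (\<forall>h. r h = r\<^sub>0)) \<and>
      (C > 1 / (real n - 1) \<longrightarrow>
        (\<forall>h. r 0 \<le> r h) \<and>
        (\<exists>h\<^sub>1>0. \<forall>h. sgn (deriv (deriv r) h) = sgn (h\<^sub>1 - \<bar>h\<bar>)) \<and>
        filterlim r at_top at_top) \<and>
      (1 / real n < C \<and> C < 1 / (real n - 1) \<longrightarrow>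
        (\<forall>h. r h \<le> r 0) \<and>
        (\<exists>h\<^sub>1>0. \<forall>h. sgn (deriv (deriv r) h) = sgn (\<bar>h\<bar> - h\<^sub>1)) \<and>
        (r \<longlongrightarrow> 0) at_top))"
proof -
  define k where "k = real n - 1"
  have k: "1 \<le> k" using assms(1) by (simp add: k_def)
  have "0 < 1 / real n" using assms(1) by simp
  then have C: "0 < C" using assms(2) by linarith
  have nC: "1 < (k + 1) * C" using assms(1,2) by (simp add: k_def field_simps)
  note unique = symmetric_expander_unique[OF C _ _ assms(3)]
  have r0: "r 0 = r\<^sub>0" if "symmetric_expander n C r\<^sub>0 r" for r
    using that by (simp add: symmetric_expander_def)
  show ?thesis
  \<comment> \<open>In each case one solution with the required behaviour is exhibited: the cylinder
    at equality, otherwise the curve between the barriers. By uniqueness every solution is this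
    one.\<close>
  proof (cases C "1 / k" rule: linorder_cases)
    case equal
    then have ex: "symmetric_expander n C r\<^sub>0 (\<lambda>_. r\<^sub>0)"
      using symmetric_expander_const assms by (simp add: k_def)
    then have eq: "r = (\<lambda>_. r\<^sub>0)" if "symmetric_expander n C r\<^sub>0 r" for r
      using unique that by blast
    have "\<exists>!r. symmetric_expander n C r\<^sub>0 r" using ex eq by blast
    then show ?thesis using eq equal unfolding k_def by auto
  next
    case greater
    then have "1 < k * C" using k by (simp add: field_simps)
    then interpret slope_barriers k C 1 "(k * C - 1) / (k * C + 3 + 2 * C)" "6 * C * k\<^sup>2" "6 * C * k\<^sup>2"
      by (rule slope_barriers_expanding[OF k C])
    obtain t where t: "symmetric_expander n C r\<^sub>0 t" "\<forall>h. r\<^sub>0 \<le> t h"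
      "\<exists>h1>0. \<forall>h. sgn (deriv (deriv t) h) = sgn (h1 - \<bar>h\<bar>)" "filterlim t at_top at_top"
      using symmetric_expander_exists[OF assms(3) k_def] by auto
    then have eq: "r = t" if "symmetric_expander n C r\<^sub>0 r" for r
      using unique that by blast
    have "\<exists>!r. symmetric_expander n C r\<^sub>0 r" using t(1) eq by blast
    moreover have "t 0 = r\<^sub>0" by (rule r0[OF t(1)])
    ultimately show ?thesis using t(2-4) eq greater unfolding k_def by simp (metis less_asym less_irrefl)
  next
    case less
    then have "k * C < 1" using k by (simp add: field_simps)
    then interpret slope_barriers k C "-1" "(1 - k * C) / 4" 1 "(k + 1 - 1 / C) * C\<^sup>2 / 8"
      by (rule slope_barriers_contracting[OF k C _ nC])
    obtain t where t: "symmetric_expander n C r\<^sub>0 t" "\<forall>h. t h \<le> r\<^sub>0"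
      "\<exists>h1>0. \<forall>h. sgn (deriv (deriv t) h) = - sgn (h1 - \<bar>h\<bar>)" "(t \<longlongrightarrow> 0) at_top"
      using symmetric_expander_exists[OF assms(3) k_def] by auto
    then have "\<exists>h1>0. \<forall>h. sgn (deriv (deriv t) h) = sgn (\<bar>h\<bar> - h1)"
      by (metis minus_diff_eq sgn_minus)
    moreover have eq: "r = t" if "symmetric_expander n C r\<^sub>0 r" for r
      using unique that t(1) by blast
    moreover have "\<exists>!r. symmetric_expander n C r\<^sub>0 r" using t(1) eq by blast
    moreover have "t 0 = r\<^sub>0" by (rule r0[OF t(1)])
    ultimately show ?thesis using t(2,4) less unfolding k_def by simp (metis less_asym less_irrefl)
  qed
qed

end
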